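(* Let $\mathbb{K}$ be an algebraically closed field of characteristic zero, let $r,s\ge 0$ be integers, and let $G_{r,s}\subseteq\operatorname{Aut}(\mathbb{K}^2)$ be the subgroup generated by the two one-parameter subgroups $$L_r=\{(x,y)\mapsto (x+\alpha y^r,\,y) : \alpha\in\mathbb{K}\},\qquad R_s=\{(x,y)\mapsto (x,\,y+\beta x^s) : \beta\in\mathbb{K}\}.$$ Then the group $G_{r,s}$ acts on a (non-empty, $G_{r,s}$-invariant) open subset $\mathcal{O}$ in $\mathbb{K}^2$ infinitely transitively if and only if $rs=2$. In the latter case, $\mathcal{O}=\mathbb{K}^2\setminus\{0\}$.
   Context: $\operatorname{Aut}(\mathbb{K}^2)$ is the group of polynomial automorphisms of the affine plane $\mathbb{K}^2$. An action of a group $G$ on a set $X$ is infinitely transitive if for every positive integer $m$ and any two $m$-tuples of pairwise distinct points of $X$ there is an element $g\in G$ sending the first tuple to the second. *)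

theory Defs
  imports
    "HOL-Algebra.Generated_Groups"
    "HOL-Algebra.Group_Action"
    "HOL-Computational_Algebra.Polynomial"
begin

section \<open>The affine plane\<close>

text \<open>
  The field is a type \<open>'a\<close> and the affine plane is \<open>'a \<times> 'a\<close>. Polynomials in two variables are
  elements of \<open>'a poly poly\<close>: the outer variable is \<open>y\<close>, the inner variable (of the coefficients)
  is \<open>x\<close>.
\<close>

definition eval2 :: "'a::comm_ring_1 poly poly \<Rightarrow> 'a \<times> 'a \<Rightarrow> 'a" where
  "eval2 P v = poly (poly P [:snd v:]) (fst v)"

definition zariski_closed :: "('a::comm_ring_1 \<times> 'a) set \<Rightarrow> bool" where
  "zariski_closed Z \<longleftrightarrow> (\<exists>S. Z = {v. \<forall>P\<in>S. eval2 P v = 0})"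

definition zariski_open :: "('a::comm_ring_1 \<times> 'a) set \<Rightarrow> bool" where
  "zariski_open U \<longleftrightarrow> zariski_closed (- U)"


section \<open>Polynomial automorphisms\<close>

definition polynomial_map :: "('a::comm_ring_1 \<times> 'a \<Rightarrow> 'a \<times> 'a) \<Rightarrow> bool" where
  "polynomial_map f \<longleftrightarrow> (\<exists>P Q. \<forall>v. f v = (eval2 P v, eval2 Q v))"

text \<open>
  Over an infinite field a polynomial is determined by its values, so polynomial automorphisms can
  be identified with the maps they induce on points.
\<close>

definition Aut_plane :: "('a::comm_ring_1 \<times> 'a \<Rightarrow> 'a \<times> 'a) monoid" where
  "Aut_plane = \<lparr>
     carrier = {f. polynomial_map f \<and> (\<exists>g. polynomial_map g \<and> f \<circ> g = id \<and> g \<circ> f = id)},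
     monoid.mult = (\<circ>),
     one = id\<rparr>"

definition L_subgroup :: "nat \<Rightarrow> ('a::comm_ring_1 \<times> 'a \<Rightarrow> 'a \<times> 'a) set" where
  "L_subgroup r = {(\<lambda>(x, y). (x + \<alpha> * y ^ r, y)) | \<alpha>. True}"

definition R_subgroup :: "nat \<Rightarrow> ('a::comm_ring_1 \<times> 'a \<Rightarrow> 'a \<times> 'a) set" where
  "R_subgroup s = {(\<lambda>(x, y). (x, y + \<beta> * x ^ s)) | \<beta>. True}"

definition G_group :: "nat \<Rightarrow> nat \<Rightarrow> ('a::comm_ring_1 \<times> 'a \<Rightarrow> 'a \<times> 'a) monoid" where
  "G_group r s = subgroup_generated Aut_plane (L_subgroup r \<union> R_subgroup s)"


section \<open>Infinite transitivity\<close>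

text \<open>Tuples of pairwise distinct points are represented by distinct lists.\<close>

definition infinitely_transitive ::
  "('g, 'b) monoid_scheme \<Rightarrow> 'x set \<Rightarrow> ('g \<Rightarrow> 'x \<Rightarrow> 'x) \<Rightarrow> bool" where
  "infinitely_transitive G X \<phi> \<longleftrightarrow> group_action G X \<phi> \<and>
     (\<forall>m>0. \<forall>ps qs. length ps = m \<and> length qs = m \<and> distinct ps \<and> distinct qs \<and>
        set ps \<subseteq> X \<and> set qs \<subseteq> X \<longrightarrow> (\<exists>g\<in>carrier G. map (\<phi> g) ps = qs))"

definition invariant_set :: "('x \<Rightarrow> 'x, 'b) monoid_scheme \<Rightarrow> 'x set \<Rightarrow> bool" where
  "invariant_set G X \<longleftrightarrow> (\<forall>g\<in>carrier G. g ` X \<subseteq> X)"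

text \<open>
  The tautological action on \<open>X\<close> of a group of self-maps; the library's group actions take values
  in functions that are undefined outside \<open>X\<close>, hence the restriction.
\<close>

definition tautological_action :: "'x set \<Rightarrow> ('x \<Rightarrow> 'x) \<Rightarrow> 'x \<Rightarrow> 'x" where
  "tautological_action X g = restrict g X"


section \<open>Basic facts\<close>

lemma polynomial_map_iff:
  "polynomial_map f \<longleftrightarrow> (\<exists>P. \<forall>v. fst (f v) = eval2 P v) \<and> (\<exists>Q. \<forall>v. snd (f v) = eval2 Q v)"
  unfolding polynomial_map_def prod_eq_iff fst_conv snd_conv by blast

lemma eval2_add: "eval2 (P + Q) v = eval2 P v + eval2 Q v"
  by (simp add: eval2_def)

lemma eval2_mult: "eval2 (P * Q) v = eval2 P v * eval2 Q v"
  by (simp add: eval2_def)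

lemma eval2_const: "eval2 [:[:c:]:] v = c"
  by (simp add: eval2_def)

lemma eval2_subst:
  assumes A: "\<And>v. fst (f v) = eval2 A v" and B: "\<And>v. snd (f v) = eval2 B v"
  shows "\<exists>R. \<forall>v. eval2 P (f v) = eval2 R v"
proof (induction P)
  case 0
  have "eval2 0 (f v) = eval2 0 v" for v
    by (simp add: eval2_def)
  then show ?case by blast
next
  case (pCons p P)
  have "\<exists>R. \<forall>v. poly p (fst (f v)) = eval2 R v"
  proof (induction p)
    case 0
    have "poly 0 (fst (f v)) = eval2 0 v" for v
      by (simp add: eval2_def)
    then show ?case by blast
  next
    case (pCons c p)
    then obtain R where "\<And>v. poly p (fst (f v)) = eval2 R v" by blast
    then have "poly (pCons c p) (fst (f v)) = eval2 ([:[:c:]:] + A * R) v" for v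
      by (simp add: eval2_add eval2_mult eval2_const A)
    then show ?case by blast
  qed
  then obtain R1 where R1: "\<And>v. poly p (fst (f v)) = eval2 R1 v" by blast
  obtain R2 where R2: "\<And>v. eval2 P (f v) = eval2 R2 v" using pCons by blast
  have "eval2 (pCons p P) (f v) = eval2 (R1 + B * R2) v" for v
    using R1[of v] R2[of v] B[of v] by (simp add: eval2_add eval2_mult) (simp add: eval2_def)
  then show ?case by blast
qed

lemma polynomial_map_comp:
  assumes "polynomial_map f" "polynomial_map g"
  shows "polynomial_map (f \<circ> g)"
proof -
  obtain A B where g: "\<And>v. fst (g v) = eval2 A v" "\<And>v. snd (g v) = eval2 B v"
    using assms(2) unfolding polynomial_map_iff by blast
  obtain P Q where f: "\<And>v. fst (f v) = eval2 P v" "\<And>v. snd (f v) = eval2 Q v"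
    using assms(1) unfolding polynomial_map_iff by blast
  show ?thesis
    using eval2_subst[OF g, of P] eval2_subst[OF g, of Q]
    unfolding polynomial_map_iff comp_apply f by blast
qed

lemma polynomial_map_id: "polynomial_map id"
  unfolding polynomial_map_def
  by (rule exI[of _ "[:[:0, 1:]:]"], rule exI[of _ "[:0, 1:]"]) (simp add: eval2_def)

lemma group_Aut_plane: "group (Aut_plane :: ('a::comm_ring_1 \<times> 'a \<Rightarrow> 'a \<times> 'a) monoid)"
proof (rule groupI)
  fix f g :: "'a \<times> 'a \<Rightarrow> 'a \<times> 'a"
  assume f: "f \<in> carrier Aut_plane" and g: "g \<in> carrier Aut_plane"
  obtain f' where f': "polynomial_map f'" "f \<circ> f' = id" "f' \<circ> f = id"
    using f by (auto simp: Aut_plane_def)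
  obtain g' where g': "polynomial_map g'" "g \<circ> g' = id" "g' \<circ> g = id"
    using g by (auto simp: Aut_plane_def)
  have "(f \<circ> g) \<circ> (g' \<circ> f') = id" "(g' \<circ> f') \<circ> (f \<circ> g) = id"
    using f' g' by (metis comp_assoc comp_id)+
  then show "f \<otimes>\<^bsub>Aut_plane\<^esub> g \<in> carrier Aut_plane"
    using f g f'(1) g'(1) polynomial_map_comp unfolding Aut_plane_def by auto
next
  show "\<one>\<^bsub>Aut_plane\<^esub> \<in> carrier (Aut_plane :: ('a \<times> 'a \<Rightarrow> 'a \<times> 'a) monoid)"
    using polynomial_map_id by (auto simp: Aut_plane_def)
qed (auto simp: Aut_plane_def comp_assoc)

lemma L_subgroup_subset_Aut: "L_subgroup r \<subseteq> carrier Aut_plane"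
proof -
  have "polynomial_map (\<lambda>(x, y). (x + \<alpha> * y ^ r, y))" for \<alpha> :: 'a
    unfolding polynomial_map_def
    by (rule exI[of _ "[:[:0, 1:]:] + [:[:\<alpha>:]:] * [:0, 1:] ^ r"], rule exI[of _ "[:0, 1:]"])
      (auto simp: eval2_def)
  note poly = this
  show ?thesis
  proof
    fix f :: "'a \<times> 'a \<Rightarrow> 'a \<times> 'a"
    assume "f \<in> L_subgroup r"
    then obtain \<alpha> where f: "f = (\<lambda>(x, y). (x + \<alpha> * y ^ r, y))"
      by (auto simp: L_subgroup_def)
    have "f \<circ> (\<lambda>(x, y). (x + (- \<alpha>) * y ^ r, y)) = id" "(\<lambda>(x, y). (x + (- \<alpha>) * y ^ r, y)) \<circ> f = id"
      by (auto simp: f fun_eq_iff)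
    moreover have "polynomial_map f"
      unfolding f by (rule poly)
    moreover have "polynomial_map (\<lambda>(x, y). (x + (- \<alpha>) * y ^ r, y))"
      by (rule poly)
    ultimately show "f \<in> carrier Aut_plane"
      unfolding Aut_plane_def by fastforce
  qed
qed

lemma R_subgroup_subset_Aut: "R_subgroup s \<subseteq> carrier Aut_plane"
proof -
  have "polynomial_map (\<lambda>(x, y). (x, y + \<beta> * x ^ s))" for \<beta> :: 'a
    unfolding polynomial_map_def
    by (rule exI[of _ "[:[:0, 1:]:]"], rule exI[of _ "[:0, 1:] + [:[:\<beta>:]:] * [:[:0, 1:]:] ^ s"])
      (auto simp: eval2_def)
  note poly = this
  show ?thesis
  proof
    fix f :: "'a \<times> 'a \<Rightarrow> 'a \<times> 'a"
    assume "f \<in> R_subgroup s"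
    then obtain \<beta> where f: "f = (\<lambda>(x, y). (x, y + \<beta> * x ^ s))"
      by (auto simp: R_subgroup_def)
    have "f \<circ> (\<lambda>(x, y). (x, y + (- \<beta>) * x ^ s)) = id" "(\<lambda>(x, y). (x, y + (- \<beta>) * x ^ s)) \<circ> f = id"
      by (auto simp: f fun_eq_iff)
    moreover have "polynomial_map f"
      unfolding f by (rule poly)
    moreover have "polynomial_map (\<lambda>(x, y). (x, y + (- \<beta>) * x ^ s))"
      by (rule poly)
    ultimately show "f \<in> carrier Aut_plane"
      unfolding Aut_plane_def by fastforce
  qed
qed

lemma carrier_G_group:
  "carrier (G_group r s :: ('a::comm_ring_1 \<times> 'a \<Rightarrow> 'a \<times> 'a) monoid) =
     generate Aut_plane (L_subgroup r \<union> R_subgroup s)"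
proof -
  have "carrier Aut_plane \<inter> (L_subgroup r \<union> R_subgroup s) =
      (L_subgroup r \<union> R_subgroup s :: ('a \<times> 'a \<Rightarrow> 'a \<times> 'a) set)"
    using L_subgroup_subset_Aut[of r] R_subgroup_subset_Aut[of s] by blast
  then show ?thesis
    by (simp only: G_group_def carrier_subgroup_generated)
qed

lemma group_G_group: "group (G_group r s)"
  unfolding G_group_def by (rule group.group_subgroup_generated[OF group_Aut_plane])

lemma mult_G_group: "f \<otimes>\<^bsub>G_group r s\<^esub> g = f \<circ> g"
  by (simp add: G_group_def subgroup_generated_def Aut_plane_def)

lemma group_action_tautological:
  assumes inv: "invariant_set (G_group r s) X"
  shows "group_action (G_group r s) X (tautological_action X)"
proof -
  interpret G: group "G_group r s" by (rule group_G_group)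
  have bij: "restrict g X \<in> Bij X" if g: "g \<in> carrier (G_group r s)" for g
  proof -
    define h where "h = inv\<^bsub>G_group r s\<^esub> g"
    have h: "h \<in> carrier (G_group r s)" using g by (simp add: h_def)
    have one: "\<one>\<^bsub>G_group r s\<^esub> = id"
      by (simp add: G_group_def subgroup_generated_def Aut_plane_def)
    have "g \<circ> h = id" "h \<circ> g = id"
      using G.r_inv[OF g] G.l_inv[OF g] by (simp_all add: h_def mult_G_group one)
    then have gh: "g (h v) = v" "h (g v) = v" for v
      by (metis comp_apply id_apply)+
    have "g \<in> X \<rightarrow> X" "h \<in> X \<rightarrow> X"
      using inv g h by (auto simp only: invariant_set_def Pi_iff image_subset_iff)
    then have "bij_betw g X X"
      by (rule bij_betwI) (simp_all add: gh)
    then show ?thesis by (simp add: Bij_def)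
  qed
  have "restrict (f \<circ> g) X = compose X (restrict f X) (restrict g X)"
    if "g \<in> carrier (G_group r s)" for f g
    using that inv by (auto simp: invariant_set_def compose_def restrict_def fun_eq_iff)
  then have "tautological_action X \<in> hom (G_group r s) (BijGroup X)"
    using bij by (auto simp: hom_def BijGroup_def mult_G_group tautological_action_def)
  then show ?thesis
    by (intro group_action.intro group_hom.intro group_hom_axioms.intro group_G_group group_BijGroup)
qed

end

theory Submission
  imports Defs
begin

text \<open>
  If \<open>rs \<noteq> 2\<close>, some polynomial automorphism \<open>t \<noteq> id\<close> commutes with \<open>L\<^sub>r\<close> and \<open>R\<^sub>s\<close>: a translation
  if \<open>rs = 0\<close>, and otherwise \<open>(x, y) \<mapsto> (\<omega>\<^sup>r x, \<omega> y)\<close> with \<open>\<omega>\<close> to the power \<open>rs\<close> equal to \<open>\<omega> \<noteq> 0, 1\<close>.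
  The group then preserves the graph of \<open>t\<close> and is not even 2-transitive.

  If \<open>rs = 2\<close>, we may take \<open>(r, s) = (1, 2)\<close> and pass from \<open>n\<close>- to \<open>(n + 1)\<close>-transitivity. Let
  \<open>f\<close> be the first coordinate of a group element \<open>w\<close>. The conjugate of \<open>R\<close> by \<open>w\<close> fixes the curve
  \<open>f = 0\<close> pointwise and moves freely along the other level curves. Hence the stabilizer of points
  in the finite set \<open>Z = {x = f = 0}\<close> is transitive off \<open>Z\<close>, and only points of \<open>Z\<close> can have finite
  orbits under it. If the stabilizer of \<open>n\<close> points had a further point with finite orbit, one could
  fix \<open>n - 1\<close> points \<open>J \<subseteq> Z\<close> and find \<open>p, q\<close>, with \<open>q\<close> of finite orbit under the stabilizer of
  \<open>J \<union> {p}\<close>, such that \<open>q\<close> follows \<open>p\<close> along all these shears and lies on \<open>f = 0\<close> whenever \<open>p\<close> does.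
  Comparing the restrictions of \<open>f\<close> to the lines \<open>x = a\<close> and \<open>x = l a\<close> through \<open>p\<close> and \<open>q\<close>
  gives \<open>1 + l a = l\<^sup>4 (1 + a)\<close>, and only finitely many \<open>l\<close> can occur as \<open>a\<close> varies. So
  \<open>l = 1\<close>, which forces \<open>q = p\<close>.
\<close>

section \<open>The group generated by the two root subgroups\<close>

lemma one_G_group: "\<one>\<^bsub>G_group r s\<^esub> = id"
  by (simp add: G_group_def subgroup_generated_def Aut_plane_def)

lemma shear_in_G_group:
  shows "(\<lambda>(x, y). (x + \<alpha> * y ^ r, y)) \<in> carrier (G_group r s)"
    and "(\<lambda>(x, y). (x, y + \<beta> * x ^ s)) \<in> carrier (G_group r s)"
  unfolding carrier_G_group by (auto intro!: generate.incl simp: L_subgroup_def R_subgroup_def)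

lemma G_group_id: "id \<in> carrier (G_group r s)"
  using group.is_monoid[OF group_G_group, THEN monoid.one_closed] by (simp only: one_G_group)

lemma G_group_comp:
  "f \<in> carrier (G_group r s) \<Longrightarrow> g \<in> carrier (G_group r s) \<Longrightarrow> f \<circ> g \<in> carrier (G_group r s)"
  using group.is_monoid[OF group_G_group, THEN monoid.m_closed] by (metis mult_G_group)

lemma G_group_inverse:
  assumes "g \<in> carrier (G_group r s)"
  shows "\<exists>h\<in>carrier (G_group r s). h \<circ> g = id \<and> g \<circ> h = id"
  using group.inv_closed[OF group_G_group assms] group.l_inv[OF group_G_group assms]
    group.r_inv[OF group_G_group assms] by (auto simp: mult_G_group one_G_group)

text \<open>The inverse of a generator is the generator with negated parameter, so products of
  generators exhaust the group.\<close>

lemma G_group_induct [consumes 1, case_names id L R comp]: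
  assumes g: "g \<in> carrier (G_group r s)"
    and id: "P id"
    and L: "\<And>\<alpha>. P (\<lambda>(x, y). (x + \<alpha> * y ^ r, y))"
    and R: "\<And>\<beta>. P (\<lambda>(x, y). (x, y + \<beta> * x ^ s))"
    and comp: "\<And>f g. P f \<Longrightarrow> P g \<Longrightarrow> P (f \<circ> g)"
  shows "P g"
  using g unfolding carrier_G_group
proof (induction rule: generate.induct)
  case one
  have "\<one>\<^bsub>Aut_plane\<^esub> = (id :: 'a \<times> 'a \<Rightarrow> 'a \<times> 'a)" by (simp add: Aut_plane_def)
  then show ?case using id by (simp only:)
next
  case (incl h)
  then show ?case using L R by (auto simp: L_subgroup_def R_subgroup_def)
next
  case (inv h)
  have h: "h \<in> carrier Aut_plane"
    using inv L_subgroup_subset_Aut[of r] R_subgroup_subset_Aut[of s] by blast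
  consider \<alpha> where "h = (\<lambda>(x, y). (x + \<alpha> * y ^ r, y))"
    | \<beta> where "h = (\<lambda>(x, y). (x, y + \<beta> * x ^ s))"
    using inv by (auto simp: L_subgroup_def R_subgroup_def)
  then show ?case
  proof cases
    case (1 \<alpha>)
    have "inv\<^bsub>Aut_plane\<^esub> h = (\<lambda>(x, y). (x + (- \<alpha>) * y ^ r, y))"
    proof (rule group.inv_equality[OF group_Aut_plane _ h])
      show "(\<lambda>(x, y). (x + (- \<alpha>) * y ^ r, y)) \<in> carrier Aut_plane"
        by (rule subsetD[OF L_subgroup_subset_Aut[of r]])
          (simp only: L_subgroup_def mem_Collect_eq, rule exI[of _ "- \<alpha>"], simp)
    qed (auto simp: Aut_plane_def 1 fun_eq_iff)
    then show ?thesis using L by (simp only:)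
  next
    case (2 \<beta>)
    have "inv\<^bsub>Aut_plane\<^esub> h = (\<lambda>(x, y). (x, y + (- \<beta>) * x ^ s))"
    proof (rule group.inv_equality[OF group_Aut_plane _ h])
      show "(\<lambda>(x, y). (x, y + (- \<beta>) * x ^ s)) \<in> carrier Aut_plane"
        by (rule subsetD[OF R_subgroup_subset_Aut[of s]])
          (simp only: R_subgroup_def mem_Collect_eq, rule exI[of _ "- \<beta>"], simp)
    qed (auto simp: Aut_plane_def 2 fun_eq_iff)
    then show ?thesis using R by (simp only:)
  qed
next
  case (eng f g)
  then show ?case using comp by (simp only: Aut_plane_def monoid.simps)
qed

lemma G_group_zero:
  assumes "g \<in> carrier (G_group r s)" "r \<noteq> 0" "s \<noteq> 0"
  shows "g (0, 0) = (0, 0)"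
  using assms by (induction rule: G_group_induct) (auto simp: power_0_left)

text \<open>Exchanging the coordinates turns \<open>L_subgroup\<close> into
  \<open>R_subgroup\<close> with the same exponent. This reduces the exponents (2, 1) to (1,
  2).\<close>

lemma prod_swap_G_group:
  fixes g :: "'a::comm_ring_1 \<times> 'a \<Rightarrow> 'a \<times> 'a"
  assumes "g \<in> carrier (G_group r s)"
  shows "prod.swap \<circ> g \<circ> prod.swap \<in> carrier (G_group s r)"
  using assms
proof (induction rule: G_group_induct)
  case id
  have "prod.swap \<circ> id \<circ> prod.swap = (id :: 'a \<times> 'a \<Rightarrow> 'a \<times> 'a)" by auto
  then show ?case by (simp only: G_group_id)
next
  case (L \<alpha>)
  have "prod.swap \<circ> (\<lambda>(x, y). (x + \<alpha> * y ^ r, y)) \<circ> prod.swap = (\<lambda>(x, y). (x, y + \<alpha> * x ^ r))"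
    by (auto simp: fun_eq_iff)
  then show ?case by (simp only: shear_in_G_group)
next
  case (R \<beta>)
  have "prod.swap \<circ> (\<lambda>(x, y). (x, y + \<beta> * x ^ s)) \<circ> prod.swap = (\<lambda>(x, y). (x + \<beta> * y ^ s, y))"
    by (auto simp: fun_eq_iff)
  then show ?case by (simp only: shear_in_G_group)
next
  case (comp f g)
  have "prod.swap \<circ> (f \<circ> g) \<circ> prod.swap
      = (prod.swap \<circ> f \<circ> prod.swap) \<circ> (prod.swap \<circ> g \<circ> prod.swap)"
    by (auto simp: fun_eq_iff)
  then show ?case using G_group_comp[OF comp] by (simp only:)
qed

section \<open>Zariski open sets\<close>

text \<open>Only finitely many constants \<open>[:c:]\<close> are roots of \<open>P\<close> in the
  outer variable. Applied to products, this yields points in general position.\<close>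

lemma eval2_nonzero:
  fixes P :: "'a::{idom, ring_char_0} poly poly"
  assumes "P \<noteq> 0"
  shows "\<exists>v. eval2 P v \<noteq> 0"
proof -
  have "inj (\<lambda>c::'a. [:c:])" by (auto intro: injI)
  then have "infinite (range (\<lambda>c::'a. [:c:]))"
    using finite_imageD infinite_UNIV_char_0 by blast
  then obtain c where "poly P [:c:] \<noteq> 0"
    using poly_roots_finite[OF assms] by (metis (mono_tags, lifting) finite_subset image_subsetI mem_Collect_eq)
  then obtain x where "poly (poly P [:c:]) x \<noteq> 0"
    using poly_all_0_iff_0 by blast
  then show ?thesis by (intro exI[of _ "(x, c)"]) (simp add: eval2_def)
qed

lemma zariski_open_nonempty:
  fixes U :: "('a::comm_ring_1 \<times> 'a) set"
  assumes "zariski_open U" "U \<noteq> {}"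
  obtains P where "P \<noteq> 0" "{v. eval2 P v \<noteq> 0} \<subseteq> U"
proof -
  obtain S where S: "- U = {v. \<forall>P\<in>S. eval2 P v = 0}"
    using assms(1) by (auto simp: zariski_open_def zariski_closed_def)
  obtain v where "v \<in> U" using assms(2) by blast
  then obtain P where "P \<in> S" "eval2 P v \<noteq> 0" using S by blast
  then have "P \<noteq> 0" "{v. eval2 P v \<noteq> 0} \<subseteq> U" using S by (auto simp: eval2_def)
  then show ?thesis by (rule that)
qed

text \<open>A group commuting with \<open>t\<close> cannot send a pair \<open>(p, t p)\<close> to a pair \<open>(p, q)\<close> with
  \<open>q \<noteq> t p\<close>.\<close>

lemma commuting_map_not_infinitely_transitive:
  fixes t :: "'a::{idom, ring_char_0} \<times> 'a \<Rightarrow> 'a \<times> 'a"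
  assumes t: "polynomial_map t" "surj t" "t \<noteq> id"
    and L: "\<And>\<alpha> x y. t (x + \<alpha> * y ^ r, y) = (\<lambda>(x, y). (x + \<alpha> * y ^ r, y)) (t (x, y))"
    and R: "\<And>\<beta> x y. t (x, y + \<beta> * x ^ s) = (\<lambda>(x, y). (x, y + \<beta> * x ^ s)) (t (x, y))"
    and U: "zariski_open (U :: ('a \<times> 'a) set)" "U \<noteq> {}"
  shows "\<not> infinitely_transitive (G_group r s) U (tautological_action U)"
proof
  assume trans: "infinitely_transitive (G_group r s) U (tautological_action U)"
  have comm: "g (t v) = t (g v)" if "g \<in> carrier (G_group r s)" for g v
    using that
  proof (induction arbitrary: v rule: G_group_induct)
    case (L \<alpha>) show ?case by (cases v) (simp add: assms(4))
  next
    case (R \<beta>) show ?case by (cases v) (simp add: assms(5))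
  qed auto
  obtain P :: "'a poly poly" where P: "P \<noteq> 0" "{v. eval2 P v \<noteq> 0} \<subseteq> U"
    using zariski_open_nonempty[OF U] .
  obtain A B where AB: "\<And>v. fst (t v) = eval2 A v" "\<And>v. snd (t v) = eval2 B v"
    using t(1) unfolding polynomial_map_iff by blast
  obtain T where T: "\<And>v. eval2 P (t v) = eval2 T v"
    using eval2_subst[OF AB, of P] by blast
  have "T \<noteq> 0"
    using eval2_nonzero[OF P(1)] T t(2) by (metis eval2_def poly_0 surjD)
  \<comment> \<open>\<open>C\<close> is a coordinate of \<open>t\<close> minus that of the identity;
    where it is nonzero, the point is not fixed.\<close>
  obtain C where C: "C \<noteq> 0" "\<And>v. eval2 C v \<noteq> 0 \<Longrightarrow> t v \<noteq> v"
  proof -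
    obtain v where "t v \<noteq> v" using t(3) by (auto simp: fun_eq_iff)
    then consider "fst (t v) \<noteq> fst v" | "snd (t v) \<noteq> snd v" by (auto simp: prod_eq_iff)
    then show ?thesis
    proof cases
      case 1
      have "eval2 (A - [:[:0, 1:]:]) w = fst (t w) - fst w" for w
        by (simp add: AB eval2_def)
      then show ?thesis using 1 that[of "A - [:[:0, 1:]:]"]
        by (metis eval2_def poly_0 right_minus_eq)
    next
      case 2
      have "eval2 (B - [:0, 1:]) w = snd (t w) - snd w" for w
        by (simp add: AB eval2_def)
      then show ?thesis using 2 that[of "B - [:0, 1:]"]
        by (metis eval2_def poly_0 right_minus_eq)
    qed
  qed
  obtain p where p: "eval2 (P * T * C) p \<noteq> 0"
    using eval2_nonzero P(1) C(1) \<open>T \<noteq> 0\<close> by (metis mult_eq_0_iff)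
  then have pU: "p \<in> U" "t p \<in> U" "t p \<noteq> p"
    using P(2) C(2) T[of p] by (auto simp: eval2_mult subset_iff simp del: split_paired_All)
  \<comment> \<open>The two linear factors keep \<open>q\<close> off the horizontal lines through
    \<open>p\<close> and \<open>t p\<close>.\<close>
  obtain q where q: "eval2 (P * [:[:- snd p:], 1:] * [:[:- snd (t p):], 1:]) q \<noteq> 0"
    using eval2_nonzero P(1) by (metis mult_eq_0_iff one_neq_zero pCons_eq_0_iff)
  then have "eval2 P q \<noteq> 0" "snd q \<noteq> snd p" "snd q \<noteq> snd (t p)"
    by (auto simp: eval2_def)
  then have qU: "q \<in> U" "q \<noteq> p" "q \<noteq> t p" using P(2) by auto
  have "\<exists>g\<in>carrier (G_group r s). map (tautological_action U g) [p, t p] = [p, q]"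
    using trans pU qU unfolding infinitely_transitive_def
    by (elim conjE allE[of _ 2] allE[of _ "[p, t p]"] allE[of _ "[p, q]"] impE) auto
  then obtain g where "g \<in> carrier (G_group r s)" "g p = p" "g (t p) = q"
    using pU by (auto simp: tautological_action_def)
  then show False using comm qU by metis
qed

section \<open>Commuting automorphisms for exponents with \<open>r * s\<close> different from
  2\<close>

text \<open>\<open>w\<close> is a root of 1 + x + ... + x^(n-1), whose value \<open>n\<close> at 1
  is nonzero in characteristic zero.\<close>

lemma root_of_unity_neq_1:
  assumes "n \<ge> 2"
  obtains w :: "'a::{alg_closed_field, field_char_0}" where "w ^ n = 1" "w \<noteq> 1"
proof -
  define p :: "'a poly" where "p = (\<Sum>k<n. monom 1 k)"
  have coeff: "coeff p k = (if k < n then 1 else 0)" for k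
    by (simp add: p_def coeff_sum)
  have "degree p \<ge> 1" by (rule le_degree) (use assms in \<open>simp add: coeff\<close>)
  then obtain w where w: "poly p w = 0" using alg_closed_imp_poly_has_root[of p] by auto
  have p: "poly p w = (\<Sum>k<n. w ^ k)" by (simp add: p_def poly_sum poly_monom)
  have "w \<noteq> 1" using w p assms by auto
  moreover have "w ^ n = 1"
    using w p power_diff_1_eq[of w n] by simp
  ultimately show ?thesis using that by blast
qed

lemma not_infinitely_transitive:
  fixes U :: "('a::{alg_closed_field, field_char_0} \<times> 'a) set"
  assumes "r * s \<noteq> 2" "zariski_open U" "U \<noteq> {}"
  shows "\<not> infinitely_transitive (G_group r s) U (tautological_action U)"
proof -
  consider "r = 0" | "s = 0" | "r * s = 1" | "r * s \<ge> 3" 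
    using assms(1) mult_eq_0_iff[of r s] by linarith
  then show ?thesis
  proof cases
    case 1
    \<comment> \<open>For \<open>r = 0\<close> the maps in \<open>L\<close> are horizontal
      translations, and the term added by a shear in \<open>R\<close> is independent of
      \<open>y\<close>.\<close>
    define t :: "'a \<times> 'a \<Rightarrow> 'a \<times> 'a" where "t = (\<lambda>(x, y). (x, y + 1))"
    show ?thesis
    proof (rule commuting_map_not_infinitely_transitive[of t])
      show "polynomial_map t" unfolding polynomial_map_def t_def
        by (rule exI[of _ "[:[:0, 1:]:]"], rule exI[of _ "[:1, 1:]"]) (auto simp: eval2_def)
      show "surj t" by (rule surjI[of t "\<lambda>(x, y). (x, y - 1)"]) (auto simp: t_def)
      have "t (0, 0) \<noteq> (0, 0)" by (simp add: t_def)
      then show "t \<noteq> id" by auto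
    qed (use 1 assms in \<open>auto simp: t_def\<close>)
  next
    case 2
    define t :: "'a \<times> 'a \<Rightarrow> 'a \<times> 'a" where "t = (\<lambda>(x, y). (x + 1, y))"
    show ?thesis
    proof (rule commuting_map_not_infinitely_transitive[of t])
      show "polynomial_map t" unfolding polynomial_map_def t_def
        by (rule exI[of _ "[:[:1, 1:]:]"], rule exI[of _ "[:0, 1:]"]) (auto simp: eval2_def)
      show "surj t" by (rule surjI[of t "\<lambda>(x, y). (x - 1, y)"]) (auto simp: t_def)
      have "t (0, 0) \<noteq> (0, 0)" by (simp add: t_def)
      then show "t \<noteq> id" by auto
    qed (use 2 assms in \<open>auto simp: t_def\<close>)
  next
    case 3
    \<comment> \<open>For \<open>r = s = 1\<close> the group is linear, so scalars commute with
      it.\<close>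
    define t :: "'a \<times> 'a \<Rightarrow> 'a \<times> 'a" where "t = (\<lambda>(x, y). (2 * x, 2 * y))"
    show ?thesis
    proof (rule commuting_map_not_infinitely_transitive[of t])
      show "polynomial_map t" unfolding polynomial_map_def t_def
        by (rule exI[of _ "[:[:0, 2:]:]"], rule exI[of _ "[:0, 2:]"]) (auto simp: eval2_def)
      show "surj t" by (rule surjI[of t "\<lambda>(x, y). (x / 2, y / 2)"]) (auto simp: t_def)
      have "t (1, 0) \<noteq> (1, 0)" by (simp add: t_def)
      then show "t \<noteq> id" by auto
    qed (use 3 assms in \<open>auto simp: t_def algebra_simps\<close>)
  next
    case 4
    then have "2 \<le> r * s - 1" by simp
    \<comment> \<open>For \<open>r * s = 2\<close> the exponent would be 1 and leave only
      \<open>w = 1\<close>.\<close>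
    then obtain w :: 'a where w: "w ^ (r * s - 1) = 1" "w \<noteq> 1"
      using root_of_unity_neq_1 by metis
    then have "w \<noteq> 0" using 4 by (auto simp: power_0_left split: if_splits)
    have "w ^ (r * s) = w * w ^ (r * s - 1)"
      using 4 by (metis One_nat_def Suc_pred less_le_trans power_Suc zero_less_numeral)
    then have wrs: "(w ^ r) ^ s = w" using w by (simp add: power_mult)
    define t :: "'a \<times> 'a \<Rightarrow> 'a \<times> 'a" where "t = (\<lambda>(x, y). (w ^ r * x, w * y))"
    show ?thesis
    proof (rule commuting_map_not_infinitely_transitive[of t])
      show "polynomial_map t" unfolding polynomial_map_def t_def
        by (rule exI[of _ "[:[:0, w ^ r:]:]"], rule exI[of _ "[:0, [:w:]:]"]) (auto simp: eval2_def)
      show "surj t" using \<open>w \<noteq> 0\<close>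
        by (intro surjI[of t "\<lambda>(x, y). (x / w ^ r, y / w)"]) (auto simp: t_def)
      have "t (0, 1) \<noteq> (0, 1)" using w by (simp add: t_def)
      then show "t \<noteq> id" by auto
      show "t (x + \<alpha> * y ^ r, y) = (\<lambda>(x, y). (x + \<alpha> * y ^ r, y)) (t (x, y))" for \<alpha> x y
        by (simp add: t_def power_mult_distrib distrib_left)
      show "t (x, y + \<beta> * x ^ s) = (\<lambda>(x, y). (x, y + \<beta> * x ^ s)) (t (x, y))" for \<beta> x y
        by (simp add: t_def power_mult_distrib wrs distrib_left)
    qed (use assms in auto)
  qed
qed

section \<open>Polynomials with prescribed second coefficient and simple roots\<close>

text \<open>Only index pairs avoiding \<open>m - 1\<close> and everything above \<open>m\<close>
  contribute: (m, m), none, and (m, m - 2) in both orders. This carries the three top coefficients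
  through the recursion for \<open>X\<^sub>j\<close>.\<close>

lemma coeff_square_centered:
  fixes p :: "'a::comm_ring_1 poly"
  assumes "degree p \<le> m" "m \<ge> 2" "coeff p (m - 1) = 0"
  shows "coeff (p * p) (2 * m) = coeff p m ^ 2"
    and "coeff (p * p) (2 * m - 1) = 0"
    and "coeff (p * p) (2 * m - 2) = 2 * coeff p m * coeff p (m - 2)"
proof -
  have zero: "coeff p i = 0" if "i > m \<or> i = m - 1" for i
    using that assms by (auto intro: coeff_eq_0)
  have "coeff (p * p) (2 * m) = (\<Sum>i\<in>{m}. coeff p i * coeff p (2 * m - i))"
    unfolding coeff_mult
  proof (rule sum.mono_neutral_right)
    show "\<forall>i\<in>{..2 * m} - {m}. coeff p i * coeff p (2 * m - i) = 0"
    proof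
      fix i assume "i \<in> {..2 * m} - {m}"
      then have "i > m \<or> 2 * m - i > m" by auto
      then show "coeff p i * coeff p (2 * m - i) = 0" using zero by auto
    qed
  qed auto
  then show "coeff (p * p) (2 * m) = coeff p m ^ 2"
    by (simp add: power2_eq_square mult_2)
  show "coeff (p * p) (2 * m - 1) = 0"
    unfolding coeff_mult
  proof (rule sum.neutral, rule ballI)
    fix i assume "i \<in> {..2 * m - 1}"
    then have "(i > m \<or> i = m - 1) \<or> (2 * m - 1 - i > m \<or> 2 * m - 1 - i = m - 1)"
      using assms(2) by auto
    then show "coeff p i * coeff p (2 * m - 1 - i) = 0" using zero by auto
  qed
  have "coeff (p * p) (2 * m - 2) = (\<Sum>i\<in>{m - 2, m}. coeff p i * coeff p (2 * m - 2 - i))"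
    unfolding coeff_mult
  proof (rule sum.mono_neutral_right)
    show "\<forall>i\<in>{..2 * m - 2} - {m - 2, m}. coeff p i * coeff p (2 * m - 2 - i) = 0"
    proof
      fix i assume "i \<in> {..2 * m - 2} - {m - 2, m}"
      then have "(i > m \<or> i = m - 1) \<or> 2 * m - 2 - i > m" using assms(2) by auto
      then show "coeff p i * coeff p (2 * m - 2 - i) = 0" using zero by auto
    qed
  qed (use assms(2) in auto)
  also have "\<dots> = coeff p (m - 2) * coeff p m + coeff p m * coeff p (m - 2)"
  proof -
    have "2 * m - 2 - (m - 2) = m" "2 * m - 2 - m = m - 2" "m - 2 \<noteq> m" using assms(2) by auto
    then show ?thesis by simp
  qed
  finally show "coeff (p * p) (2 * m - 2) = 2 * coeff p m * coeff p (m - 2)"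
    by (simp add: algebra_simps)
qed

text \<open>\<open>p\<close> splits into linear factors, and squarefreeness makes its multiset of
  roots a set.\<close>

lemma card_roots_rsquarefree:
  fixes p :: "'a::{alg_closed_field, field_char_0} poly"
  assumes "rsquarefree p"
  shows "card {x. poly p x = 0} = degree p"
proof -
  have "p \<noteq> 0" using assms by (simp add: rsquarefree_def)
  obtain M where M: "size M = degree p" "p = smult (lead_coeff p) (\<Prod>x\<in>#M. [:-x, 1:])"
    using alg_closed_imp_factorization[OF \<open>p \<noteq> 0\<close>] by blast
  have "proots p = proots (\<Prod>x\<in>#M. [:-x, 1:])"
    using M(2) \<open>p \<noteq> 0\<close> by (metis leading_coeff_0_iff proots_smult)
  also have "\<dots> = M"
  proof (induction M)
    case (add x M)
    have "(\<Prod>x\<in>#M. [:- x, 1:]) \<noteq> 0" by (auto simp: prod_mset_zero_iff)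
    then show ?case
      using add by (simp add: proots_mult del: mult_pCons_left mult_pCons_right)
  qed simp
  finally have proots: "proots p = M" .
  have "count M x = (if x \<in># M then 1 else 0)" for x
    using rsquarefree_root_order[OF assms _ \<open>p \<noteq> 0\<close>, of x] \<open>p \<noteq> 0\<close> count_proots[of p x]
    by (auto simp: order_root count_eq_zero_iff proots[symmetric])
  then have "M = mset_set (set_mset M)"
    by (intro multiset_eqI) auto
  then have "size M = card (set_mset M)" by (metis size_mset_set)
  then show ?thesis using M(1) \<open>p \<noteq> 0\<close> by (simp flip: proots)
qed

text \<open>A multiple root \<open>c\<close> of \<open>A + \<gamma> B\<^sup>2\<close> is a critical point of \<open>A / B\<^sup>2\<close> with critical
  value \<open>- \<gamma>\<close>.\<close>

lemma finite_not_rsquarefree: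
  fixes A B :: "'a::field_char_0 poly"
  assumes deg: "degree A > 0" "degree B = 2 * degree A"
    and simple: "\<And>c. poly A c = 0 \<Longrightarrow> poly B c = 0 \<Longrightarrow> poly (pderiv A) c \<noteq> 0"
  shows "finite {\<gamma>. \<not> rsquarefree (A + smult \<gamma> (B * B))}"
proof -
  \<comment> \<open>\<open>W / B^3\<close> is the derivative of \<open>A / B^2\<close>.\<close>
  define W where "W = pderiv A * B - smult 2 (A * pderiv B)"
  have "W \<noteq> 0"
  proof
    assume "W = 0"
    \<comment> \<open>The leading coefficients of the two terms of \<open>W\<close> carry the
      factors \<open>degree A\<close> and \<open>4 * degree A\<close>, so they cannot
      cancel.\<close>
    have lead_coeff_pderiv: "lead_coeff (pderiv p) = of_nat (degree p) * lead_coeff p"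
      if "degree p > 0" for p :: "'a poly"
      using that by (simp add: degree_pderiv coeff_pderiv)
    from \<open>W = 0\<close> have "lead_coeff (pderiv A * B) = lead_coeff (smult 2 (A * pderiv B))"
      by (simp add: W_def)
    then have "of_nat (degree A) * lead_coeff A * lead_coeff B
        = 2 * (lead_coeff A * (of_nat (2 * degree A) * lead_coeff B))"
      using deg by (simp only: lead_coeff_mult lead_coeff_smult lead_coeff_pderiv)
    moreover have "A \<noteq> 0" "B \<noteq> 0" using deg by auto
    then have "lead_coeff A \<noteq> 0" "lead_coeff B \<noteq> 0" by (simp_all only: leading_coeff_0_iff) auto
    ultimately have "of_nat (degree A) = (of_nat (4 * degree A) :: 'a)" by (simp add: field_simps)
    then show False using deg(1) by (simp only: of_nat_eq_iff)
  qed
  have "{\<gamma>. \<not> rsquarefree (A + smult \<gamma> (B * B))} \<subseteq> (\<lambda>c. - poly A c / poly B c ^ 2) ` {c. poly W c = 0}"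
  proof
    fix \<gamma> assume "\<gamma> \<in> {\<gamma>. \<not> rsquarefree (A + smult \<gamma> (B * B))}"
    then obtain c where "poly (A + smult \<gamma> (B * B)) c = 0" "poly (pderiv (A + smult \<gamma> (B * B))) c = 0"
      unfolding rsquarefree_roots by blast
    then have c: "poly A c + \<gamma> * (poly B c * poly B c) = 0"
      "poly (pderiv A) c + \<gamma> * (2 * poly B c * poly (pderiv B) c) = 0"
      by (simp_all add: pderiv_add pderiv_smult pderiv_mult mult.assoc)
    have B: "poly B c \<noteq> 0" using c simple[of c] by auto
    have A: "poly A c = - \<gamma> * poly B c ^ 2" "poly (pderiv A) c = - \<gamma> * (2 * poly B c * poly (pderiv B) c)"
      using c by (simp_all add: power2_eq_square add_eq_0_iff2)
    have "poly W c = 0" by (simp add: W_def A algebra_simps power2_eq_square)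
    moreover have "\<gamma> = - poly A c / poly B c ^ 2" using A B by simp
    ultimately show "\<gamma> \<in> (\<lambda>c. - poly A c / poly B c ^ 2) ` {c. poly W c = 0}" by blast
  qed
  then show ?thesis using poly_roots_finite[OF \<open>W \<noteq> 0\<close>] finite_surj by blast
qed

section \<open>Words in the generators\<close>

text \<open>
  Applying alternately \<open>R\<close> and \<open>L\<close> produces first coordinates \<open>X\<^sub>j\<close> with
  \<open>X\<^sub>j\<^sub>+\<^sub>1 = X\<^sub>j\<^sub>-\<^sub>1 + \<gamma> X\<^sub>j\<^sup>2\<close>. A pair \<open>(A, B)\<close> stands for \<open>(X\<^sub>j\<^sub>-\<^sub>1, X\<^sub>j)\<close>; on the line where the
  first coordinate is \<open>x\<close> both are polynomials in \<open>x + y + 1\<close>, a variable in which the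
  second-highest coefficient vanishes.
\<close>

definition word_pair ::
    "nat \<Rightarrow> ('a::{alg_closed_field, field_char_0} \<Rightarrow> 'a poly) \<Rightarrow> ('a \<Rightarrow> 'a poly) \<Rightarrow> bool" where
  "word_pair d A B \<longleftrightarrow> d > 0 \<and>
     (\<exists>s\<in>{1, -1}. \<exists>w\<in>carrier (G_group 1 2). \<forall>x y. w (x, y) =
        (poly (B x) (x + y + 1), s * (poly (B x) (x + y + 1) - poly (A x) (x + y + 1)))) \<and>
     (\<forall>x. degree (A x) = d \<and> degree (B x) = 2 * d) \<and>
     (\<exists>\<kappa>. \<kappa> \<noteq> 0 \<and> (\<forall>x. coeff (B x) (2 * d) = \<kappa> \<and> coeff (B x) (2 * d - 1) = 0 \<and>
        coeff (B x) (2 * d - 2) = - (\<kappa> * of_nat d * (1 + x)))) \<and>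
     (\<forall>x c. poly (A x) c = 0 \<and> poly (B x) c = 0 \<longrightarrow> x = 0 \<and> c = 1) \<and>
     poly (A 0) 1 = 0 \<and> poly (B 0) 1 = 0 \<and>
     poly (pderiv (A 0)) 1 \<noteq> 0 \<and> poly (pderiv (B 0)) 1 \<noteq> 0"

text \<open>In the word \<open>L\<close>, \<open>R\<close>, \<open>L\<close> with all parameters 1,
  the first coordinates are \<open>x + y\<close> and \<open>(x + y)^2 + x + 2 * y\<close>.
  Completing the square in the latter produces the variable \<open>x + y + 1\<close>.\<close>

lemma word_pair_base:
  "word_pair 1 (\<lambda>x. [:-1, 1:]) (\<lambda>x :: 'a::{alg_closed_field, field_char_0}. [:- (1 + x), 0, 1:])"
proof -
  define w :: "'a \<times> 'a \<Rightarrow> 'a \<times> 'a" where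
    "w = (\<lambda>(x, y). (x + 1 * y ^ 1, y)) \<circ> (\<lambda>(x, y). (x, y + 1 * x ^ 2)) \<circ> (\<lambda>(x, y). (x + 1 * y ^ 1, y))"
  have "w \<in> carrier (G_group 1 2)"
    unfolding w_def by (intro G_group_comp shear_in_G_group)
  moreover have "w (x, y) = (poly [:- (1 + x), 0, 1:] (x + y + 1),
      1 * (poly [:- (1 + x), 0, 1:] (x + y + 1) - poly [:-1, 1:] (x + y + 1)))" for x y
    by (simp add: w_def algebra_simps power2_eq_square)
  ultimately show ?thesis
    unfolding word_pair_def by (auto simp: pderiv_pCons coeff_pCons split: nat.splits)
qed

text \<open>Since the second coordinate is \<open>s\<close> times the difference of the last two
  first coordinates, one \<open>R\<close> followed by one \<open>L\<close> appends the next term of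
  the recursion and flips the sign \<open>s\<close>.\<close>

lemma word_pair_step:
  assumes AB: "word_pair d A B" and "\<gamma> \<noteq> 0"
  shows "word_pair (2 * d) B (\<lambda>x. A x + smult \<gamma> (B x * B x))" (is "word_pair _ _ ?C")
proof -
  obtain s w \<kappa> where s: "s \<in> {1, -1}" and w: "w \<in> carrier (G_group 1 2)"
      "\<forall>x y. w (x, y) = (poly (B x) (x + y + 1), s * (poly (B x) (x + y + 1) - poly (A x) (x + y + 1)))"
    and d: "d > 0" and deg': "\<forall>x. degree (A x) = d \<and> degree (B x) = 2 * d"
    and \<kappa>: "\<kappa> \<noteq> 0" and B': "\<forall>x. coeff (B x) (2 * d) = \<kappa> \<and> coeff (B x) (2 * d - 1) = 0 \<and>
        coeff (B x) (2 * d - 2) = - (\<kappa> * of_nat d * (1 + x))"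
    and common: "\<forall>x c. poly (A x) c = 0 \<and> poly (B x) c = 0 \<longrightarrow> x = 0 \<and> c = 1"
    and at_1: "poly (A 0) 1 = 0" "poly (B 0) 1 = 0" "poly (pderiv (A 0)) 1 \<noteq> 0"
      "poly (pderiv (B 0)) 1 \<noteq> 0"
    using AB unfolding word_pair_def by (elim conjE bexE exE) (rule that)
  note deg = deg'[THEN spec, THEN conjunct1] deg'[THEN spec, THEN conjunct2]
  note B = B'[THEN spec, THEN conjunct1] B'[THEN spec, THEN conjunct2, THEN conjunct1]
    B'[THEN spec, THEN conjunct2, THEN conjunct2]
  define w' where "w' = (\<lambda>(x, y). (x + (- s) * y ^ 1, y)) \<circ> ((\<lambda>(x, y). (x, y + (- s * \<gamma>) * x ^ 2)) \<circ> w)"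
  have "w' \<in> carrier (G_group 1 2)"
    unfolding w'_def by (intro G_group_comp shear_in_G_group w(1))
  moreover have "w' (x, y) = (poly (?C x) (x + y + 1), - s * (poly (?C x) (x + y + 1) - poly (B x) (x + y + 1)))" for x y
    using s by (elim insertE emptyE) (simp_all add: w'_def w(2) algebra_simps power2_eq_square)
  moreover have "- s \<in> {1, -1}" using s by auto
  ultimately have word: "\<exists>s\<in>{1, -1}. \<exists>w\<in>carrier (G_group 1 2). \<forall>x y. w (x, y) =
        (poly (?C x) (x + y + 1), s * (poly (?C x) (x + y + 1) - poly (B x) (x + y + 1)))"
    by (intro bexI[of _ "- s"] bexI[of _ w'] allI)
  \<comment> \<open>As \<open>4 * d - 2 > d\<close>, the summand \<open>A\<close> does not reach the
    three top coefficients.\<close>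
  have C: "coeff (?C x) i = \<gamma> * coeff (B x * B x) i" if "i > d" for x i
    using that deg(1)[of x] by (simp add: coeff_eq_0)
  have sq: "coeff (B x * B x) (2 * (2 * d)) = \<kappa> ^ 2" "coeff (B x * B x) (2 * (2 * d) - 1) = 0"
    "coeff (B x * B x) (2 * (2 * d) - 2) = 2 * \<kappa> * (- (\<kappa> * of_nat d * (1 + x)))" for x
    using coeff_square_centered[of "B x" "2 * d"] d deg(2)[of x] by (simp_all only: B)
  have coeffs: "coeff (?C x) (2 * (2 * d)) = \<gamma> * \<kappa> ^ 2" "coeff (?C x) (2 * (2 * d) - 1) = 0"
    "coeff (?C x) (2 * (2 * d) - 2) = - (\<gamma> * \<kappa> ^ 2 * of_nat (2 * d) * (1 + x))" for x
    using d C[of "2 * (2 * d)" x] C[of "2 * (2 * d) - 1" x] C[of "2 * (2 * d) - 2" x]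
    unfolding sq by (simp_all add: algebra_simps power2_eq_square)
  have "degree (?C x) = 2 * (2 * d)" for x
  proof (rule antisym)
    show "degree (?C x) \<le> 2 * (2 * d)"
      by (intro degree_add_le order.trans[OF degree_smult_le] order.trans[OF degree_mult_le])
        (auto simp: deg)
    show "degree (?C x) \<ge> 2 * (2 * d)"
      by (rule le_degree) (use coeffs(1) \<kappa> \<open>\<gamma> \<noteq> 0\<close> in auto)
  qed
  then have degs: "\<forall>x. degree (B x) = 2 * d \<and> degree (?C x) = 2 * (2 * d)"
    using deg(2) by simp
  have "\<gamma> * \<kappa> ^ 2 \<noteq> 0" using \<kappa> \<open>\<gamma> \<noteq> 0\<close> by simp
  then have coeffs': "\<exists>\<kappa>. \<kappa> \<noteq> 0 \<and> (\<forall>x. coeff (?C x) (2 * (2 * d)) = \<kappa> \<and> coeff (?C x) (2 * (2 * d) - 1) = 0 \<and>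
        coeff (?C x) (2 * (2 * d) - 2) = - (\<kappa> * of_nat (2 * d) * (1 + x)))"
    using coeffs by (intro exI[of _ "\<gamma> * \<kappa> ^ 2"]) (simp only: simp_thms)
  have common_C: "\<forall>x c. poly (B x) c = 0 \<and> poly (?C x) c = 0 \<longrightarrow> x = 0 \<and> c = 1"
  proof (intro allI impI)
    fix x c assume "poly (B x) c = 0 \<and> poly (?C x) c = 0"
    then have "poly (A x) c = 0 \<and> poly (B x) c = 0" by auto
    then show "x = 0 \<and> c = 1" using common by blast
  qed
  have at_1_C: "poly (?C 0) 1 = 0" "poly (pderiv (?C 0)) 1 \<noteq> 0"
    using at_1 by (simp_all add: pderiv_add pderiv_smult pderiv_mult)
  have "2 * d > 0" using d by simp
  show ?thesis
    unfolding word_pair_def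
    by (rule conjI \<open>2 * d > 0\<close> word degs coeffs' common_C at_1 at_1_C)+
qed

lemma word_pair_exists:
  obtains d A and B :: "'a::{alg_closed_field, field_char_0} \<Rightarrow> 'a poly" where "d \<ge> n" "word_pair d A B"
proof -
  have "\<exists>d A. \<exists>B :: 'a \<Rightarrow> 'a poly. d \<ge> n \<and> word_pair d A B"
  proof (induction n)
    case 0
    show ?case by (intro exI conjI, rule le0, rule word_pair_base)
  next
    case (Suc n)
    then obtain d A and B :: "'a \<Rightarrow> 'a poly" where d: "d \<ge> n" "word_pair d A B" by blast
    have "d > 0" using d(2) by (simp add: word_pair_def)
    show ?case
    proof (intro exI conjI)
      show "2 * d \<ge> Suc n" using d(1) \<open>d > 0\<close> by simp
      show "word_pair (2 * d) B (\<lambda>x. A x + smult 1 (B x * B x))"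
        by (rule word_pair_step[OF d(2)]) simp
    qed
  qed
  then show ?thesis using that by blast
qed

text \<open>A \<open>word_pair\<close> of large degree is extended by one step whose parameter
  \<open>\<gamma>\<close> avoids the finitely many values giving multiple roots on one of the lines
  \<open>x = 0, ..., 4 * m + 1\<close>, where \<open>m = 2 * d\<close>.\<close>

lemma ex_separable_word:
  obtains m \<kappa> w and F :: "'a::{alg_closed_field, field_char_0} \<Rightarrow> 'a poly" where
    "m > n" "\<kappa> \<noteq> 0" "w \<in> carrier (G_group 1 2)"
    "\<And>x y. fst (w (x, y)) = poly (F x) (x + y + 1)"
    "\<And>x. degree (F x) = 2 * m" "\<And>x. coeff (F x) (2 * m) = \<kappa>" "\<And>x. coeff (F x) (2 * m - 1) = 0"
    "\<And>x. coeff (F x) (2 * m - 2) = - (\<kappa> * of_nat m * (1 + x))"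
    "\<And>i. i \<le> 4 * m + 1 \<Longrightarrow> card {c. poly (F (of_nat i)) c = 0} = 2 * m"
proof -
  obtain d A and B :: "'a \<Rightarrow> 'a poly" where d: "d \<ge> Suc n" "word_pair d A B"
    using word_pair_exists by blast
  have deg_AB: "degree (A x) = d" "degree (B x) = 2 * d" "d > 0" for x
    using d(2) by (simp_all add: word_pair_def)
  have common: "x = 0 \<and> c = 1" if "poly (A x) c = 0" "poly (B x) c = 0" for x c
    using that d(2) unfolding word_pair_def by (elim conjE) blast
  have at_1: "poly (pderiv (A 0)) 1 \<noteq> 0" using d(2) by (simp add: word_pair_def)
  define bad where "bad i = {\<gamma>. \<not> rsquarefree (A (of_nat i) + smult \<gamma> (B (of_nat i) * B (of_nat i)))}" for i
  have "finite (bad i)" for i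
    unfolding bad_def
  proof (rule finite_not_rsquarefree)
    \<comment> \<open>Common roots occur only at the origin (\<open>i = 0\<close>,
      \<open>c = 1\<close>), a fixed point of every word, and there \<open>A\<close> has a simple
      root.\<close>
    show "poly (pderiv (A (of_nat i))) c \<noteq> 0"
      if "poly (A (of_nat i)) c = 0" "poly (B (of_nat i)) c = 0" for c
      using common[OF that] at_1 by simp
  qed (simp_all add: deg_AB)
  then have "finite ({0} \<union> (\<Union>i\<le>4 * (2 * d) + 1. bad i))" by blast
  then obtain \<gamma> where "\<gamma> \<notin> {0} \<union> (\<Union>i\<le>4 * (2 * d) + 1. bad i)"
    using ex_new_if_finite[OF infinite_UNIV_char_0] by blast
  then have \<gamma>: "\<gamma> \<noteq> 0"
    "\<And>i. i \<le> 4 * (2 * d) + 1 \<Longrightarrow> rsquarefree (A (of_nat i) + smult \<gamma> (B (of_nat i) * B (of_nat i)))"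
    by (auto simp: bad_def)
  define F where "F = (\<lambda>x. A x + smult \<gamma> (B x * B x))"
  have "word_pair (2 * d) B F" unfolding F_def by (rule word_pair_step[OF d(2) \<gamma>(1)])
  then obtain s w \<kappa> where w: "w \<in> carrier (G_group 1 2)"
      "\<forall>x y. w (x, y) = (poly (F x) (x + y + 1), s * (poly (F x) (x + y + 1) - poly (B x) (x + y + 1)))"
    and deg: "\<forall>x. degree (B x) = 2 * d \<and> degree (F x) = 2 * (2 * d)"
    and \<kappa>: "\<kappa> \<noteq> 0" and F: "\<forall>x. coeff (F x) (2 * (2 * d)) = \<kappa> \<and> coeff (F x) (2 * (2 * d) - 1) = 0 \<and>
        coeff (F x) (2 * (2 * d) - 2) = - (\<kappa> * of_nat (2 * d) * (1 + x))"
    unfolding word_pair_def by (elim conjE bexE exE) (rule that)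
  show ?thesis
  proof (rule that)
    show "2 * d > n" using d(1) by simp
    show "card {c. poly (F (of_nat i)) c = 0} = 2 * (2 * d)" if "i \<le> 4 * (2 * d) + 1" for i
      using card_roots_rsquarefree[OF \<gamma>(2)[OF that]] deg by (simp add: F_def)
    show "degree (F x) = 2 * (2 * d)" for x using deg by simp
    show "fst (w (x, y)) = poly (F x) (x + y + 1)" for x y using w(2) by simp
  qed (use \<kappa> w(1) F in blast)+
qed

section \<open>Multiple transitivity of transformation groups\<close>

locale transformation_group =
  fixes H :: "('x \<Rightarrow> 'x) set" and X :: "'x set"
  assumes id_in: "id \<in> H"
    and comp_in: "g \<in> H \<Longrightarrow> h \<in> H \<Longrightarrow> g \<circ> h \<in> H"
    and inverse_in: "g \<in> H \<Longrightarrow> \<exists>h\<in>H. h \<circ> g = id \<and> g \<circ> h = id"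
    and preserves: "g \<in> H \<Longrightarrow> x \<in> X \<Longrightarrow> g x \<in> X"
begin

definition fixer :: "'x set \<Rightarrow> ('x \<Rightarrow> 'x) set" where
  "fixer S = {g \<in> H. \<forall>x\<in>S. g x = x}"

definition same_orbit :: "'x set \<Rightarrow> 'x \<Rightarrow> 'x \<Rightarrow> bool" where
  "same_orbit S u v \<longleftrightarrow> (\<exists>g\<in>fixer S. g u = v)"

definition finite_orbits :: "'x set \<Rightarrow> 'x set" where
  "finite_orbits S = {q \<in> X - S. finite {v. same_orbit S q v}}"

definition tuple_transitive :: "nat \<Rightarrow> bool" where
  "tuple_transitive n \<longleftrightarrow> (\<forall>ps qs. length ps = n \<and> length qs = n \<and> distinct ps \<and> distinct qs \<and>
     set ps \<subseteq> X \<and> set qs \<subseteq> X \<longrightarrow> (\<exists>g\<in>H. map g ps = qs))"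

lemma obtain_inverse:
  assumes "g \<in> H"
  obtains h where "h \<in> H" "\<And>x. h (g x) = x" "\<And>x. g (h x) = x"
  using inverse_in[OF assms] by (auto simp: fun_eq_iff)

lemma inj_H: "g \<in> H \<Longrightarrow> g x = g y \<longleftrightarrow> x = y"
  by (metis obtain_inverse)

lemma same_orbit_sym: "same_orbit S u v \<Longrightarrow> same_orbit S v u"
proof -
  assume "same_orbit S u v"
  then obtain g where g: "g \<in> H" "\<And>x. x \<in> S \<Longrightarrow> g x = x" "g u = v"
    by (auto simp: same_orbit_def fixer_def)
  obtain h where h: "h \<in> H" "\<And>x. h (g x) = x" using obtain_inverse[OF g(1)] by blast
  have "h x = x" if "x \<in> S" for x using h(2)[of x] g(2)[OF that] by simp
  then show ?thesis
    unfolding same_orbit_def fixer_def using h g(3) by (intro bexI[of _ h]) auto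
qed

lemma same_orbit_trans: "same_orbit S u v \<Longrightarrow> same_orbit S v w \<Longrightarrow> same_orbit S u w"
proof -
  assume "same_orbit S u v" "same_orbit S v w"
  then obtain g h where "g \<in> fixer S" "g u = v" "h \<in> fixer S" "h v = w"
    by (auto simp: same_orbit_def)
  then show ?thesis
    unfolding same_orbit_def fixer_def using comp_in by (intro bexI[of _ "h \<circ> g"]) auto
qed

text \<open>Conjugation by \<open>g\<close> carries the pointwise stabilizer of \<open>S\<close> to
  that of the image of \<open>S\<close>.\<close>

lemma finite_orbits_image:
  assumes g: "g \<in> H" and q: "q \<in> finite_orbits S"
  shows "g q \<in> finite_orbits (g ` S)"
proof -
  obtain h where h: "h \<in> H" "\<And>x. h (g x) = x" "\<And>x. g (h x) = x" using obtain_inverse[OF g] by blast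
  have "{v. same_orbit (g ` S) (g q) v} \<subseteq> g ` {v. same_orbit S q v}"
  proof
    fix v assume "v \<in> {v. same_orbit (g ` S) (g q) v}"
    then obtain k where k: "k \<in> H" "\<And>x. x \<in> S \<Longrightarrow> k (g x) = g x" "k (g q) = v"
      by (auto simp: same_orbit_def fixer_def)
    have "h \<circ> (k \<circ> g) \<in> fixer S"
      using g h(1,2) k(1,2) by (auto simp: fixer_def intro!: comp_in)
    then have "same_orbit S q (h v)"
      unfolding same_orbit_def using k(3) by (intro bexI[of _ "h \<circ> (k \<circ> g)"]) simp_all
    then show "v \<in> g ` {v. same_orbit S q v}" using h(3) by (metis image_eqI mem_Collect_eq)
  qed
  then have "finite {v. same_orbit (g ` S) (g q) v}"
    using q by (auto simp: finite_orbits_def intro: finite_subset)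
  then show ?thesis
    using q g preserves inj_H[OF g] by (auto simp: finite_orbits_def)
qed

text \<open>A point with infinite orbit can be moved off any finite set.\<close>

lemma same_orbit_cofinite:
  assumes "finite_orbits S = {}" "finite C"
    and C: "\<And>u v. u \<in> X - C \<Longrightarrow> v \<in> X - C \<Longrightarrow> same_orbit S u v"
    and uv: "u \<in> X - S" "v \<in> X - S"
  shows "same_orbit S u v"
proof -
  have move: "\<exists>u'\<in>X - C. same_orbit S u u'" if "u \<in> X - S" for u
  proof -
    have "infinite {v. same_orbit S u v}" using that assms(1) by (auto simp: finite_orbits_def)
    then have "\<not> {v. same_orbit S u v} \<subseteq> C" using \<open>finite C\<close> finite_subset by blast
    moreover have "v \<in> X" if "same_orbit S u v" for v
      using that \<open>u \<in> X - S\<close> preserves by (auto simp: same_orbit_def fixer_def)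
    ultimately show ?thesis by blast
  qed
  obtain u' v' where "u' \<in> X - C" "same_orbit S u u'" "v' \<in> X - C" "same_orbit S v v'"
    using move[OF uv(1)] move[OF uv(2)] by blast
  then show ?thesis using C same_orbit_sym same_orbit_trans by blast
qed

text \<open>Both tails are moved onto \<open>I\<close> by \<open>n\<close>-transitivity, and the
  stabilizer of \<open>I\<close> then matches the heads. A single reference tuple \<open>I\<close>
  is enough.\<close>

lemma tuple_transitive_Suc:
  assumes n: "tuple_transitive n"
    and I: "length I = n" "distinct I" "set I \<subseteq> X"
    and orbit: "\<And>u v. u \<in> X - set I \<Longrightarrow> v \<in> X - set I \<Longrightarrow> same_orbit (set I) u v"
  shows "tuple_transitive (Suc n)"
  unfolding tuple_transitive_def
proof (intro allI impI)
  fix ps qs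
  assume asm: "length ps = Suc n \<and> length qs = Suc n \<and> distinct ps \<and> distinct qs \<and> set ps \<subseteq> X \<and> set qs \<subseteq> X"
  then obtain p ps' q qs' where eq: "ps = p # ps'" "qs = q # qs'"
    by (metis length_Suc_conv)
  have move: "\<exists>g\<in>H. map g xs = I \<and> g x \<in> X - set I"
    if xs: "length (x # xs) = Suc n" "distinct (x # xs)" "set (x # xs) \<subseteq> X" for x xs
  proof -
    have "length xs = n \<and> length I = n \<and> distinct xs \<and> distinct I \<and> set xs \<subseteq> X \<and> set I \<subseteq> X"
      using xs I by simp
    then obtain g where g: "g \<in> H" "map g xs = I"
      using n unfolding tuple_transitive_def by blast
    have "set I = g ` set xs" using g(2) by (metis list.set_map)
    moreover have "g x \<notin> g ` set xs" using xs(2) inj_H[OF g(1)] by auto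
    ultimately show ?thesis using g xs(3) preserves[OF g(1)] by (intro bexI[of _ g]) auto
  qed
  obtain g where g: "g \<in> H" "map g ps' = I" "g p \<in> X - set I"
    using move[of p ps'] asm unfolding eq by blast
  obtain h where h: "h \<in> H" "map h qs' = I" "h q \<in> X - set I"
    using move[of q qs'] asm unfolding eq by blast
  obtain k where k: "k \<in> H" "\<And>x. x \<in> set I \<Longrightarrow> k x = x" "k (g p) = h q"
    using orbit[OF g(3) h(3)] unfolding same_orbit_def fixer_def by blast
  obtain h' where h': "h' \<in> H" "\<And>x. h' (h x) = x" using obtain_inverse[OF h(1)] by blast
  have "map (h' \<circ> (k \<circ> g)) ps' = map h' (map k (map g ps'))" by simp
  also have "\<dots> = map h' I" using k(2) by (simp add: g(2) map_idI)
  also have "\<dots> = qs'" unfolding h(2)[symmetric] by (simp add: h'(2) map_idI)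
  finally have "map (h' \<circ> (k \<circ> g)) ps = qs" by (simp add: eq k(3) h'(2))
  then show "\<exists>g\<in>H. map g ps = qs" using comp_in g(1) h'(1) k(1) by blast
qed

text \<open>An element moving \<open>S\<close> onto \<open>T\<close> transports finite orbits, so
  under \<open>n\<close>-transitivity one \<open>n\<close>-element set without them settles
  all.\<close>

lemma finite_orbits_transfer:
  assumes n: "tuple_transitive n"
    and S: "card S = n" "finite S" "S \<subseteq> X" and T: "card T = n" "finite T" "T \<subseteq> X"
    and "finite_orbits S \<noteq> {}"
  shows "finite_orbits T \<noteq> {}"
proof -
  obtain ps qs where "set ps = S" "distinct ps" "set qs = T" "distinct qs"
    using S(2) T(2) finite_distinct_list by metis
  moreover from this have "length ps = n" "length qs = n"
    using S(1) T(1) distinct_card by metis+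
  ultimately obtain g where "g \<in> H" "map g ps = qs"
    using n S(3) T(3) unfolding tuple_transitive_def by metis
  then have "g \<in> H" "g ` S = T" using \<open>set ps = S\<close> \<open>set qs = T\<close> by auto
  then show ?thesis using finite_orbits_image assms(8) by blast
qed

end

text \<open>Apart from its top monomial, \<open>p\<close> has degree at most \<open>n - 2\<close>,
  so both coefficients come from the binomial expansion of \<open>(b + c X)^n\<close>.\<close>

lemma coeff_pcompose_linear_second:
  fixes p :: "'a::comm_ring_1 poly"
  assumes "degree p \<le> n" "n \<ge> 2" "coeff p (n - 1) = 0"
  shows "coeff (pcompose p [:b, c:]) n = coeff p n * c ^ n"
    and "coeff (pcompose p [:b, c:]) (n - 1) = coeff p n * of_nat n * c ^ (n - 1) * b"
proof -
  define p' where "p' = p - monom (coeff p n) n"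
  have p: "p = smult (coeff p n) ([:0, 1:] ^ n) + p'"
    by (simp add: p'_def monom_altdef)
  have "coeff p' i = 0" if "i > n - 2" for i
  proof -
    have "i = n - 1 \<or> i = n \<or> i > n" using that by linarith
    then show ?thesis using assms by (auto simp: p'_def coeff_eq_0)
  qed
  then have "degree p' \<le> n - 2" by (intro degree_le) auto
  moreover have "degree [:b, c:] \<le> 1" by simp
  ultimately have "degree p' * degree [:b, c:] \<le> (n - 2) * 1" by (rule mult_le_mono)
  then have "degree p' * degree [:b, c:] \<le> n - 2" by (simp only: mult.right_neutral)
  then have "degree (pcompose p' [:b, c:]) \<le> n - 2" by (rule order.trans[OF degree_pcompose_le])
  then have zero: "coeff (pcompose p' [:b, c:]) i = 0" if "i > n - 2" for i
    using that by (simp add: coeff_eq_0)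
  have "pcompose ([:0, 1:] ^ n) r = r ^ n" for r :: "'a poly"
    by (induction n) (simp_all add: pcompose_mult pcompose_pCons pcompose_1)
  then have "pcompose p [:b, c:] = smult (coeff p n) ([:b, c:] ^ n) + pcompose p' [:b, c:]"
    by (subst p) (simp add: pcompose_add pcompose_smult)
  then have *: "coeff (pcompose p [:b, c:]) i = coeff p n * coeff ([:b, c:] ^ n) i" if "i > n - 2" for i
    using zero[OF that] by simp
  show "coeff (pcompose p [:b, c:]) n = coeff p n * c ^ n"
    using assms(2) by (subst *) (simp_all add: coeff_linear_poly_power)
  have "n choose (n - 1) = n" using assms(2) binomial_symmetric[of 1 n] by simp
  then show "coeff (pcompose p [:b, c:]) (n - 1) = coeff p n * of_nat n * c ^ (n - 1) * b"
    using assms(2) by (subst *) (simp_all add: coeff_linear_poly_power mult_ac)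
qed

section \<open>Shears and finite orbits on the punctured plane\<close>

interpretation plane: transformation_group
  "carrier (G_group 1 2) :: ('a::{alg_closed_field, field_char_0} \<times> 'a \<Rightarrow> 'a \<times> 'a) set"
  "UNIV - {(0, 0)} :: ('a \<times> 'a) set"
proof
  fix g :: "'a \<times> 'a \<Rightarrow> 'a \<times> 'a" and x :: "'a \<times> 'a"
  assume g: "g \<in> carrier (G_group 1 2)" and x: "x \<in> UNIV - {(0, 0)}"
  obtain h where "h \<circ> g = id" using G_group_inverse[OF g] by blast
  then have "inj g" by (metis inj_on_id inj_on_imageI2)
  then have "g x \<noteq> g (0, 0)" using x by (auto dest: injD)
  then show "g x \<in> UNIV - {(0, 0)}" using G_group_zero[OF g] by simp
qed (blast intro: G_group_id G_group_comp G_group_inverse)+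

text \<open>\<open>g\<close> is the conjugate by \<open>w\<close> of the shear in \<open>R\<close>
  taking \<open>w u\<close> to \<open>w v\<close>. Shears in \<open>R\<close> keep the first
  coordinate and fix the line \<open>x = 0\<close>, hence the last two properties.\<close>

lemma conjugate_shear:
  fixes w :: "'a::{alg_closed_field, field_char_0} \<times> 'a \<Rightarrow> 'a \<times> 'a"
  assumes w: "w \<in> carrier (G_group 1 2)" and uv: "fst (w u) = fst (w v)" "fst (w u) \<noteq> 0"
  obtains g where "g \<in> carrier (G_group 1 2)" "g u = v" "\<And>z. fst (w (g z)) = fst (w z)"
    "\<And>z. fst (w z) = 0 \<Longrightarrow> g z = z"
proof -
  obtain h where h: "h \<in> carrier (G_group 1 2)" "\<And>x. h (w x) = x" "\<And>x. w (h x) = x"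
    using plane.obtain_inverse[OF w] by blast
  define R where "R = (\<lambda>(x, y). (x, y + (snd (w v) - snd (w u)) / fst (w u) ^ 2 * x ^ 2))"
  have R: "R \<in> carrier (G_group 1 2)" unfolding R_def by (rule shear_in_G_group)
  have "R z = (fst z, snd z + (snd (w v) - snd (w u)) / fst (w u) ^ 2 * fst z ^ 2)" for z
    by (simp add: R_def case_prod_beta)
  note Rz = this
  have "R (w u) = w v" using uv by (simp add: Rz prod_eq_iff)
  show ?thesis
  proof (rule that)
    show "h \<circ> (R \<circ> w) \<in> carrier (G_group 1 2)" by (intro G_group_comp h R w)
    show "(h \<circ> (R \<circ> w)) u = v" by (simp add: \<open>R (w u) = w v\<close> h)
    show "fst (w ((h \<circ> (R \<circ> w)) z)) = fst (w z)" for z by (simp add: h Rz)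
    show "(h \<circ> (R \<circ> w)) z = z" if "fst (w z) = 0" for z
    proof -
      have "R (w z) = w z" using that by (simp add: Rz prod_eq_iff)
      then show ?thesis by (simp add: h)
    qed
  qed
qed

text \<open>Otherwise conjugated shears, which fix \<open>S\<close>, would slide \<open>q\<close>
  along its level curve, the preimage under \<open>w\<close> of a vertical line and so
  infinite.\<close>

lemma finite_orbits_subset_zeros:
  fixes w :: "'a::{alg_closed_field, field_char_0} \<times> 'a \<Rightarrow> 'a \<times> 'a"
  assumes w: "w \<in> carrier (G_group 1 2)" and S: "\<And>z. z \<in> S \<Longrightarrow> fst (w z) = 0"
    and q: "q \<in> plane.finite_orbits S"
  shows "fst (w q) = 0"
proof (rule ccontr)
  assume nz: "fst (w q) \<noteq> 0"
  obtain h where h: "h \<in> carrier (G_group 1 2)" "\<And>x. h (w x) = x" "\<And>x. w (h x) = x"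
    using plane.obtain_inverse[OF w] by blast
  have "inj (\<lambda>t. h (fst (w q), t))"
    by (rule injI) (metis h(3) prod.inject)
  then have "infinite (range (\<lambda>t. h (fst (w q), t)))"
    using finite_imageD infinite_UNIV_char_0 by blast
  moreover have "range (\<lambda>t. h (fst (w q), t)) \<subseteq> {v. plane.same_orbit S q v}"
  proof
    fix v assume "v \<in> range (\<lambda>t. h (fst (w q), t))"
    then have "fst (w q) = fst (w v)" by (auto simp: h)
    then obtain g where g: "g \<in> carrier (G_group 1 2)" "g q = v" "\<And>z. fst (w z) = 0 \<Longrightarrow> g z = z"
      using conjugate_shear[OF w _ nz] by metis
    then show "v \<in> {v. plane.same_orbit S q v}"
      unfolding plane.same_orbit_def plane.fixer_def using S by blast
  qed
  ultimately show False
    using q finite_subset unfolding plane.finite_orbits_def by blast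
qed

lemmas shear_R = conjugate_shear[OF G_group_id, unfolded id_apply]

section \<open>The curve \<open>f = 0\<close> and its intersection \<open>Z\<close> with the line
  \<open>x = 0\<close>\<close>

locale separable_word =
  fixes w :: "'a::{alg_closed_field, field_char_0} \<times> 'a \<Rightarrow> 'a \<times> 'a" and F :: "'a \<Rightarrow> 'a poly"
    and m :: nat and \<kappa> :: 'a
  assumes m_pos: "m > 0" and \<kappa>: "\<kappa> \<noteq> 0" and w: "w \<in> carrier (G_group 1 2)"
    and fst_w: "fst (w (x, y)) = poly (F x) (x + y + 1)"
    and degree_F: "degree (F x) = 2 * m"
    and coeff_F: "coeff (F x) (2 * m) = \<kappa>" "coeff (F x) (2 * m - 1) = 0"
      "coeff (F x) (2 * m - 2) = - (\<kappa> * of_nat m * (1 + x))"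
    and card_roots_F: "i \<le> 4 * m + 1 \<Longrightarrow> card {c. poly (F (of_nat i)) c = 0} = 2 * m"
begin

definition f :: "'a \<times> 'a \<Rightarrow> 'a" where
  "f v = fst (w v)"

text \<open>These are the points fixed by all shears in \<open>R\<close> and by all their conjugates
  under \<open>w\<close>.\<close>

definition Z :: "('a \<times> 'a) set" where
  "Z = {v. fst v = 0 \<and> f v = 0}"

lemma f_eq: "f (x, y) = poly (F x) (x + y + 1)"
  by (simp add: f_def fst_w)

lemmas shear_f = conjugate_shear[OF w, folded f_def]
lemmas finite_orbits_subset_curve = finite_orbits_subset_zeros[OF w, folded f_def]

lemma level_surj: obtains y where "f (a, y) = e"
proof -
  have "degree (F a + [:- e:]) = degree (F a)"
    using degree_F m_pos by (intro degree_add_eq_left) auto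
  then obtain c where "poly (F a + [:- e:]) c = 0"
    using alg_closed_imp_poly_has_root[of "F a + [:- e:]"] degree_F m_pos by auto
  then show ?thesis using that[of "c - a - 1"] by (simp add: f_eq algebra_simps)
qed

lemma Z_eq: "Z = (\<lambda>c. (0, c - 1)) ` {c. poly (F 0) c = 0}"
proof
  show "Z \<subseteq> (\<lambda>c. (0, c - 1)) ` {c. poly (F 0) c = 0}"
  proof
    fix v assume "v \<in> Z"
    then obtain y where "v = (0, y)" "f (0, y) = 0" by (cases v) (auto simp: Z_def)
    then show "v \<in> (\<lambda>c. (0, c - 1)) ` {c. poly (F 0) c = 0}"
      by (intro image_eqI[of _ _ "y + 1"]) (auto simp: f_eq)
  qed
qed (auto simp: Z_def f_eq)

lemma card_Z: "card Z = 2 * m"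
  unfolding Z_eq using card_roots_F[of 0] by (subst card_image) (auto simp: inj_on_def)

lemma finite_Z: "finite Z"
  using card_Z m_pos card_gt_0_iff by force

lemma zero_in_Z: "(0, 0) \<in> Z"
  using G_group_zero[OF w] by (simp add: Z_def f_def)

text \<open>Every point off \<open>Z\<close> reaches a base point in two moves. Off the line
  \<open>x = 0\<close> it slides vertically to the level \<open>f = 1\<close> and then along that
  level; on the line it first follows its own nonzero level to \<open>x = 1\<close> and then slides
  vertically.\<close>

lemma same_orbit_off_Z:
  assumes S: "S \<subseteq> Z" and uv: "u \<notin> Z" "v \<notin> Z"
  shows "plane.same_orbit S u v"
proof -
  have R: "plane.same_orbit S p q" if pq: "fst p = fst q" "fst p \<noteq> 0" for p q
  proof -
    obtain g where "g \<in> carrier (G_group 1 2)" "g p = q" "\<And>z. fst z = 0 \<Longrightarrow> g z = z"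
      using shear_R[OF pq] by blast
    then show ?thesis
      using S unfolding plane.same_orbit_def plane.fixer_def Z_def by blast
  qed
  have U: "plane.same_orbit S p q" if pq: "f p = f q" "f p \<noteq> 0" for p q
  proof -
    obtain g where "g \<in> carrier (G_group 1 2)" "g p = q" "\<And>z. f z = 0 \<Longrightarrow> g z = z"
      using shear_f[OF pq] by blast
    then show ?thesis
      using S unfolding plane.same_orbit_def plane.fixer_def Z_def by blast
  qed
  obtain y where y: "f (1, y) = 1" using level_surj .
  have to_base: "plane.same_orbit S p (1, y)" if "p \<notin> Z" for p
  proof (cases "fst p = 0")
    case False
    obtain y' where "f (fst p, y') = 1" using level_surj .
    then have "plane.same_orbit S (fst p, y') (1, y)" using y by (intro U) simp_all
    moreover have "plane.same_orbit S p (fst p, y')" using False by (intro R) simp_all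
    ultimately show ?thesis using plane.same_orbit_trans by blast
  next
    case True
    then have "f p \<noteq> 0" using that by (simp add: Z_def)
    obtain y' where "f (1, y') = f p" using level_surj .
    then have "plane.same_orbit S p (1, y')" using \<open>f p \<noteq> 0\<close> by (intro U) simp_all
    moreover have "plane.same_orbit S (1, y') (1, y)" by (intro R) simp_all
    ultimately show ?thesis using plane.same_orbit_trans by blast
  qed
  show ?thesis
    using to_base[OF uv(1)] to_base[OF uv(2)] plane.same_orbit_sym plane.same_orbit_trans by blast
qed

text \<open>
  Moving \<open>p\<close> along the line \<open>x = a\<close> moves \<open>q\<close> along \<open>x = l a\<close>, with speeds in ratio
  \<open>1 : l\<^sup>2\<close>. Whenever \<open>p\<close> meets the curve \<open>f = 0\<close>, so does \<open>q\<close>; as \<open>f\<close> has as many zeros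
  as its degree on \<open>x = a\<close>, its restrictions to both lines are proportional.
\<close>

lemma finite_orbit_rigidity:
  assumes J: "J \<subseteq> Z" and i: "0 < i" "i \<le> 4 * m + 1"
    and q: "q \<in> plane.finite_orbits (insert (of_nat i, y0) J)" and fq: "f q \<noteq> 0"
  shows "\<exists>l. l ^ (4 * m) * f (of_nat i, y0) = f q \<and> 1 + l * of_nat i = l ^ 4 * (1 + of_nat i) \<and> l \<noteq> 1"
proof -
  define a :: 'a where "a = of_nat i"
  have a: "a \<noteq> 0" using i by (simp add: a_def)
  obtain a' b' where q_eq: "q = (a', b')" by (cases q)
  define l where "l = a' / a"
  have a': "a' = l * a" using a by (simp add: l_def)
  have moved: "(a', b' + l ^ 2 * (y - y0)) \<in> plane.finite_orbits (insert (a, y) J)" for y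
  proof -
    define R where "R = (\<lambda>(x, z). (x, z + (y - y0) / a ^ 2 * x ^ 2))"
    have R: "R \<in> carrier (G_group 1 2)" unfolding R_def by (rule shear_in_G_group)
    have "R v = v" if "v \<in> J" for v
      using that J by (auto simp: R_def Z_def case_prod_beta prod_eq_iff)
    then have "R ` J = J" by force
    moreover have "R (a, y0) = (a, y)" "R q = (a', b' + l ^ 2 * (y - y0))"
      using a by (simp_all add: R_def q_eq l_def power_divide)
    ultimately show ?thesis
      using plane.finite_orbits_image[OF R q] by (simp add: a_def)
  qed
  \<comment> \<open>If \<open>(a, y)\<close> lies on the curve, so does all of
    \<open>insert (a, y) J\<close>, and hence every point with finite orbit under its
    stabilizer.\<close>
  have zero: "f (a', b' + l ^ 2 * (y - y0)) = 0" if "f (a, y) = 0" for y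
    using finite_orbits_subset_curve[OF _ moved[of y]] that J by (auto simp: Z_def)
  have l: "l \<noteq> 0"
  proof
    assume "l = 0"
    obtain y where "f (a, y) = 0" using level_surj .
    then show False using zero[of y] fq \<open>l = 0\<close> by (simp add: q_eq)
  qed
  \<comment> \<open>With \<open>c = a + y + 1\<close> as parameter on the first line, substituting
    \<open>b + l^2 c\<close> into \<open>F a'\<close> describes \<open>f\<close> along the line of
    \<open>q\<close>.\<close>
  define b where "b = a' + b' + 1 - l ^ 2 * (a + y0 + 1)"
  define Q where "Q = pcompose (F a') [:b, l ^ 2:]"
  have Q: "poly Q (a + y + 1) = f (a', b' + l ^ 2 * (y - y0))" for y
    by (simp add: Q_def poly_pcompose f_eq b_def algebra_simps)
  have m2: "2 \<le> 2 * m" using m_pos by simp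
  note coeff_Q = coeff_pcompose_linear_second[of "F a'", OF _ m2 coeff_F(2), of b "l ^ 2", folded Q_def]
  \<comment> \<open>Both sides have degree at most \<open>2 * m\<close>, share the coefficient at
    \<open>2 * m\<close>, and vanish at the \<open>2 * m\<close> roots of
    \<open>F a\<close>.\<close>
  have QF: "Q = smult (l ^ (4 * m)) (F a)"
  proof (rule poly_eqI_degree_lead_coeff)
    show "coeff Q (2 * m) = coeff (smult (l ^ (4 * m)) (F a)) (2 * m)"
      using coeff_Q(1) by (simp add: degree_F coeff_F flip: power_mult)
    show "2 * m \<le> card {c. poly (F a) c = 0}"
      using card_roots_F[OF i(2)] by (simp add: a_def)
    show "degree Q \<le> 2 * m"
      unfolding Q_def by (rule order.trans[OF degree_pcompose_le]) (simp add: degree_F)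
    show "degree (smult (l ^ (4 * m)) (F a)) \<le> 2 * m" using degree_F by simp
    show "poly Q c = poly (smult (l ^ (4 * m)) (F a)) c" if "c \<in> {c. poly (F a) c = 0}" for c
    proof -
      have "f (a, c - a - 1) = 0" using that by (simp add: f_eq)
      then show ?thesis using zero Q[of "c - a - 1"] that by simp
    qed
  qed
  \<comment> \<open>The vanishing second coefficient forces \<open>b = 0\<close>; the third then
    relates \<open>a\<close> and \<open>l\<close>.\<close>
  have "\<kappa> * of_nat (2 * m) * (l ^ 2) ^ (2 * m - 1) * b = coeff Q (2 * m - 1)"
    using coeff_Q(2) by (simp only: degree_F coeff_F order.refl simp_thms)
  also have "\<dots> = 0" unfolding QF coeff_smult coeff_F(2) by simp
  finally have "\<kappa> * of_nat (2 * m) * (l ^ 2) ^ (2 * m - 1) * b = 0" .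
  then have b: "b = 0" using \<kappa> l m_pos by simp
  have "coeff Q (2 * m - 2) = (l ^ 2) ^ (2 * m - 2) * coeff (F a') (2 * m - 2)"
    unfolding Q_def b by (rule coeff_pcompose_linear)
  then have eq: "(l ^ 2) ^ (2 * m - 2) * (\<kappa> * of_nat m * (1 + a')) = l ^ (4 * m) * (\<kappa> * of_nat m * (1 + a))"
    using QF coeff_F(3) by auto
  have "l ^ (4 * m) = (l ^ 2) ^ (2 * m - 2) * l ^ 4"
  proof -
    have "4 * m = 2 * (2 * m - 2) + 4" using m_pos by simp
    then have "l ^ (4 * m) = l ^ (2 * (2 * m - 2) + 4)" by (rule arg_cong)
    then show ?thesis unfolding power_add power_mult[of l 2] .
  qed
  then have "((l ^ 2) ^ (2 * m - 2) * (\<kappa> * of_nat m)) * (1 + a') = ((l ^ 2) ^ (2 * m - 2) * (\<kappa> * of_nat m)) * (l ^ 4 * (1 + a))"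
    using eq by (simp add: mult_ac)
  then have second: "1 + a' = l ^ 4 * (1 + a)"
    using l \<kappa> m_pos by (subst (asm) mult_cancel_left) auto
  have "l ^ (4 * m) * f (a, y0) = f q"
    using Q[of y0] QF by (simp add: q_eq f_eq[of a])
  \<comment> \<open>With \<open>l = 1\<close> and \<open>b = 0\<close>, \<open>q\<close> would be
    the fixed point \<open>(a, y0)\<close> itself.\<close>
  moreover have "l \<noteq> 1"
  proof
    assume "l = 1"
    then have "q = (a, y0)" using b a' by (simp add: q_eq b_def)
    then show False using q unfolding plane.finite_orbits_def a_def by blast
  qed
  ultimately show ?thesis using second a' unfolding a_def by (intro exI[of _ l]) simp
qed

end

section \<open>Excluding finite orbits and extending transitivity by one point\<close>

context separable_word
begin

text \<open>Sliding \<open>p\<close> along its level curve to the lines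
  \<open>x = 1, ..., 4 * m + 1\<close> leaves \<open>f q\<close> unchanged. Each line yields a ratio
  \<open>l i\<close> with the same power \<open>4 * m\<close>, so two of these
  \<open>4 * m + 1\<close> ratios coincide.\<close>

lemma no_rigid_pair:
  assumes J: "J \<subseteq> Z" and q: "q \<in> plane.finite_orbits (insert p J)" and fp: "f p \<noteq> 0"
  shows "f q = 0"
proof (rule ccontr)
  assume fq: "f q \<noteq> 0"
  have "\<exists>l. l ^ (4 * m) = f q / f p \<and> 1 + l * of_nat i = l ^ 4 * (1 + of_nat i) \<and> l \<noteq> 1"
    if i: "i \<in> {1..4 * m + 1}" for i
  proof -
    obtain y where y: "f (of_nat i, y) = f p" using level_surj .
    obtain g where g: "g \<in> carrier (G_group 1 2)" "g p = (of_nat i, y)" "\<And>z. f (g z) = f z"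
      "\<And>z. f z = 0 \<Longrightarrow> g z = z"
      using shear_f[OF y[symmetric] fp] by blast
    have "g ` J = J" using g(4) J by (force simp: Z_def)
    then have "g q \<in> plane.finite_orbits (insert (of_nat i, y) J)"
      using plane.finite_orbits_image[OF g(1) q] g(2) by simp
    then show ?thesis
      using finite_orbit_rigidity[OF J, of i "g q" y] i fq fp g(3) y by (auto simp: field_simps)
  qed
  then obtain l where l: "l i ^ (4 * m) = f q / f p"
    "1 + l i * of_nat i = l i ^ 4 * (1 + of_nat i)" "l i \<noteq> 1" if "i \<in> {1..4 * m + 1}" for i
    by metis
  have "\<not> inj_on l {1..4 * m + 1}"
  proof
    assume "inj_on l {1..4 * m + 1}"
    define P where "P = monom 1 (4 * m) - [:f q / f p:]"
    have "degree P = 4 * m"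
      unfolding P_def diff_conv_add_uminus using m_pos
      by (subst degree_add_eq_left) (auto simp: degree_monom_eq)
    then have "P \<noteq> 0" using m_pos by auto
    have "l ` {1..4 * m + 1} \<subseteq> {c. poly P c = 0}" using l(1) by (auto simp: P_def poly_monom)
    then have "card (l ` {1..4 * m + 1}) \<le> 4 * m"
      using card_mono[OF poly_roots_finite[OF \<open>P \<noteq> 0\<close>]] card_poly_roots_bound[OF \<open>P \<noteq> 0\<close>]
        \<open>degree P = 4 * m\<close> by (metis order.trans)
    then show False using card_image[OF \<open>inj_on l {1..4 * m + 1}\<close>] by simp
  qed
  then obtain i j where ij: "i \<in> {1..4 * m + 1}" "j \<in> {1..4 * m + 1}" "i \<noteq> j" "l i = l j"
    by (auto simp: inj_on_def)
  define c where "c = l i"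
  have "1 + c * of_nat i = c ^ 4 * (1 + of_nat i)" "1 + c * of_nat j = c ^ 4 * (1 + of_nat j)" "c \<noteq> 1"
    using l(2)[OF ij(1)] l(2)[OF ij(2)] l(3)[OF ij(1)] ij(4) by (simp_all add: c_def)
  \<comment> \<open>The difference of the two relations gives \<open>c^4 = c\<close>, and either
    relation then reduces to \<open>c = 1\<close>.\<close>
  moreover from this have "(c - c ^ 4) * (of_nat i - of_nat j) = 0" by algebra
  then have "c ^ 4 = c" using ij(3) by simp
  ultimately show False by (simp add: algebra_simps)
qed

lemma infinite_f_nonzero: "infinite {v. f v \<noteq> 0}"
proof -
  have "\<forall>x. \<exists>y. f (x, y) = 1" using level_surj by metis
  then obtain y where y: "\<And>x. f (x, y x) = 1" by metis
  have "range (\<lambda>x. (x, y x)) \<subseteq> {v. f v \<noteq> 0}" using y by auto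
  moreover have "infinite (range (\<lambda>x. (x, y x)))"
    using infinite_UNIV_char_0 by (auto dest!: finite_imageD simp: inj_on_def)
  ultimately show ?thesis using finite_subset by blast
qed

lemma finite_shear_zeros:
  assumes "fst v \<noteq> 0"
  shows "finite {\<beta>. f (fst v, snd v + \<beta> * fst v ^ 2) = 0}"
proof -
  have "F (fst v) \<noteq> 0" using degree_F[of "fst v"] m_pos by auto
  have "inj (\<lambda>\<beta>. fst v + (snd v + \<beta> * fst v ^ 2) + 1)"
    using assms by (auto simp: inj_on_def)
  then have "finite ((\<lambda>\<beta>. fst v + (snd v + \<beta> * fst v ^ 2) + 1) -` {c. poly (F (fst v)) c = 0})"
    by (rule finite_vimageI[OF poly_roots_finite[OF \<open>F (fst v) \<noteq> 0\<close>]])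
  then show ?thesis by (simp add: f_eq vimage_def)
qed

text \<open>Otherwise some \<open>q\<close> has finite orbit under the stabilizer of
  \<open>J\<close> and a point \<open>p\<close> off the curve, and \<open>no_rigid_pair\<close>
  forces \<open>q\<close> into \<open>Z\<close>. As the stabilizer of \<open>J\<close> and
  \<open>q\<close> is transitive off \<open>Z\<close>, the same \<open>q\<close> serves all points
  off \<open>Z\<close>. Transitivity on \<open>Suc (card J)\<close> points then moves
  \<open>q\<close> to \<open>p\<close>, against \<open>no_rigid_pair\<close>.\<close>

lemma ex_infinite_orbits:
  assumes n: "plane.tuple_transitive TYPE('a) (Suc (card J))"
    and J: "J \<subseteq> Z - {(0, 0)}"
  shows "\<exists>p\<in>UNIV - {(0, 0)} - J. plane.finite_orbits (insert p J) = {}"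
proof (rule ccontr)
  assume "\<not> ?thesis"
  then have nonempty: "plane.finite_orbits (insert p J) \<noteq> {}" if "p \<in> UNIV - {(0, 0)} - J" for p
    using that by blast
  have JZ: "J \<subseteq> Z" and "finite J" using J finite_Z finite_subset by auto
  obtain y where "f (1, y) = 1" using level_surj .
  define p where "p = (1 :: 'a, y)"
  have p: "f p = 1" "fst p = 1" using \<open>f (1, y) = 1\<close> by (simp_all add: p_def)
  have "p \<in> UNIV - {(0, 0)} - J" using p J by (auto simp: Z_def)
  then obtain q where q: "q \<in> plane.finite_orbits (insert p J)" using nonempty by blast
  have fq: "f q = 0" using no_rigid_pair[OF JZ q] p by simp
  \<comment> \<open>Off the line \<open>x = 0\<close>, a generic shear would move both
    \<open>p\<close> and \<open>q\<close> off the curve.\<close>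
  have "fst q = 0"
  proof (rule ccontr)
    assume "fst q \<noteq> 0"
    then have "finite ({\<beta>. f (fst p, snd p + \<beta> * fst p ^ 2) = 0} \<union> {\<beta>. f (fst q, snd q + \<beta> * fst q ^ 2) = 0})"
      using finite_shear_zeros[of p] finite_shear_zeros[of q] p(2) by simp
    then obtain \<beta> where \<beta>: "f (fst p, snd p + \<beta> * fst p ^ 2) \<noteq> 0" "f (fst q, snd q + \<beta> * fst q ^ 2) \<noteq> 0"
      using ex_new_if_finite[OF infinite_UNIV_char_0] by blast
    define R where "R = (\<lambda>(x, y). (x, y + \<beta> * x ^ 2))"
    have R: "R \<in> carrier (G_group 1 2)" unfolding R_def by (rule shear_in_G_group)
    have "R v = v" if "v \<in> J" for v
      using that JZ by (auto simp: R_def Z_def case_prod_beta prod_eq_iff)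
    then have "R ` J = J" by force
    then have "R q \<in> plane.finite_orbits (insert (R p) J)"
      using plane.finite_orbits_image[OF R q] by simp
    moreover have "f (R p) \<noteq> 0" "f (R q) \<noteq> 0" using \<beta> by (simp_all add: R_def case_prod_beta)
    ultimately show False using no_rigid_pair[OF JZ] by blast
  qed
  then have "q \<in> Z" using fq by (simp add: Z_def)
  have qJ: "q \<notin> J" "q \<noteq> (0, 0)" using q unfolding plane.finite_orbits_def by blast+
  have q_special: "q \<in> plane.finite_orbits (insert v J)" if "v \<notin> Z" for v
  proof -
    have "p \<notin> Z" using p by (simp add: Z_def)
    then have "plane.same_orbit (insert q J) p v"
      using same_orbit_off_Z[of "insert q J" p v] that JZ \<open>q \<in> Z\<close> by blast
    then obtain g where g: "g \<in> carrier (G_group 1 2)" "g q = q" "\<And>x. x \<in> J \<Longrightarrow> g x = x" "g p = v"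
      unfolding plane.same_orbit_def plane.fixer_def by blast
    have "g ` J = J" using g(3) by force
    then show ?thesis using plane.finite_orbits_image[OF g(1) q] g(2,4) by simp
  qed
  obtain js where js: "set js = J" "distinct js" using finite_distinct_list[OF \<open>finite J\<close>] by blast
  have "length js = card J" using js distinct_card by metis
  have "\<exists>g\<in>carrier (G_group 1 2). map g (q # js) = p # js"
    using n unfolding plane.tuple_transitive_def
  proof (elim allE impE)
    show "length (q # js) = Suc (card J) \<and> length (p # js) = Suc (card J) \<and> distinct (q # js) \<and>
        distinct (p # js) \<and> set (q # js) \<subseteq> UNIV - {(0, 0)} \<and> set (p # js) \<subseteq> UNIV - {(0, 0)}"
      using js \<open>length js = card J\<close> qJ J \<open>p \<in> UNIV - {(0, 0)} - J\<close> by auto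
  qed
  then obtain g where g: "g \<in> carrier (G_group 1 2)" "g q = p" "map g js = js" by auto
  have "g ` J = J" using g(3) js(1) by (metis list.set_map)
  \<comment> \<open>\<open>v\<close> is taken off the curve with its preimage under \<open>g\<close>
    outside \<open>Z\<close>, so that \<open>q_special\<close> applies to the preimage.\<close>
  have "infinite ({v. f v \<noteq> 0} - g ` Z)" using infinite_f_nonzero finite_Z by simp
  then have "{v. f v \<noteq> 0} - g ` Z \<noteq> {}" by (intro notI) simp
  then obtain v where v: "f v \<noteq> 0" "v \<notin> g ` Z" by blast
  obtain h where h: "\<And>x. g (h x) = x" using plane.obtain_inverse[OF g(1)] by blast
  have "h v \<notin> Z" using v(2) h[of v] imageI[of "h v" Z g] by auto
  then have "p \<in> plane.finite_orbits (insert v J)"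
    using plane.finite_orbits_image[OF g(1) q_special[OF \<open>h v \<notin> Z\<close>]] \<open>g ` J = J\<close> g(2) h by simp
  then show False using no_rigid_pair[OF JZ _ v(1)] p(1) by simp
qed

text \<open>\<open>n < 2 * m\<close> leaves room for \<open>n\<close> points \<open>T\<close> in
  \<open>Z\<close> besides the origin. Inside \<open>Z\<close>, \<open>same_orbit_off_Z\<close>
  applies, while finite orbits are excluded for \<open>insert p J\<close>;
  \<open>finite_orbits_transfer\<close> brings both together.\<close>

lemma tuple_transitive_step:
  assumes n: "plane.tuple_transitive TYPE('a) n" and "0 < n" "n < 2 * m"
  shows "plane.tuple_transitive TYPE('a) (Suc n)"
proof -
  have "n \<le> card (Z - {(0, 0)})" using card_Z zero_in_Z assms(3) finite_Z by simp
  then obtain T where T: "T \<subseteq> Z - {(0, 0)}" "card T = n" "finite T"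
    using obtain_subset_with_card_n by metis
  then have "T \<noteq> {}" using \<open>0 < n\<close> by (intro notI) simp
  then obtain t where "t \<in> T" by blast
  define J where "J = T - {t}"
  have J: "J \<subseteq> Z - {(0, 0)}" "Suc (card J) = n" "finite J"
    using T card_Suc_Diff1[OF T(3) \<open>t \<in> T\<close>] by (auto simp: J_def)
  obtain p where p: "p \<in> UNIV - {(0, 0)} - J" "plane.finite_orbits (insert p J) = {}"
    using ex_infinite_orbits[OF n[folded J(2)] J(1)] by blast
  have pJ: "card (insert p J) = n" "finite (insert p J)" "insert p J \<subseteq> UNIV - {(0, 0)}"
    using p(1) J by auto
  have TX: "T \<subseteq> UNIV - {(0, 0)}" using T(1) by blast
  have no_finite: "plane.finite_orbits T = {}"
  proof (rule ccontr)
    assume "plane.finite_orbits T \<noteq> {}"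
    then have "plane.finite_orbits (insert p J) \<noteq> {}"
      by (rule plane.finite_orbits_transfer[OF n T(2,3) TX pJ])
    then show False using p(2) by blast
  qed
  obtain ts where ts: "set ts = T" "distinct ts" using finite_distinct_list[OF T(3)] by blast
  show ?thesis
  proof (rule plane.tuple_transitive_Suc[OF n])
    show "length ts = n" "distinct ts" "set ts \<subseteq> UNIV - {(0, 0)}"
      using ts TX T(2) distinct_card[OF ts(2)] by simp_all
    show "plane.same_orbit (set ts) u v"
      if "u \<in> UNIV - {(0, 0)} - set ts" "v \<in> UNIV - {(0, 0)} - set ts" for u v
      unfolding ts(1)
    proof (rule plane.same_orbit_cofinite[OF no_finite finite_Z])
      show "plane.same_orbit T u v" if "u \<in> UNIV - {(0, 0)} - Z" "v \<in> UNIV - {(0, 0)} - Z" for u v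
        using same_orbit_off_Z[of T u v] T that by blast
    qed (use that ts in auto)
  qed
qed

end

section \<open>Tuples of every positive length in the punctured plane\<close>

lemma tuple_transitive_1:
  "plane.tuple_transitive TYPE('a::{alg_closed_field, field_char_0}) 1"
  unfolding plane.tuple_transitive_def
proof (intro allI impI)
  fix ps qs :: "('a \<times> 'a) list"
  assume asm: "length ps = 1 \<and> length qs = 1 \<and> distinct ps \<and> distinct qs \<and>
    set ps \<subseteq> UNIV - {(0, 0)} \<and> set qs \<subseteq> UNIV - {(0, 0)}"
  then obtain p q where pq: "ps = [p]" "qs = [q]" by (auto simp: length_Suc_conv)
  have R: "plane.same_orbit {} u v" if uv: "fst u = fst v" "fst u \<noteq> 0" for u v :: "'a \<times> 'a"
  proof -
    obtain g where "g \<in> carrier (G_group 1 2)" "g u = v" using shear_R[OF uv] by blast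
    then show ?thesis unfolding plane.same_orbit_def plane.fixer_def by blast
  qed
  have L: "plane.same_orbit {} u v" if uv: "snd u = snd v" "snd u \<noteq> 0" for u v :: "'a \<times> 'a"
  proof -
    define g where "g = (\<lambda>(x, y). (x + (fst v - fst u) / snd u * y ^ 1, y))"
    have "g \<in> carrier (G_group 1 2)" unfolding g_def by (rule shear_in_G_group)
    moreover have "g u = v" using uv by (simp add: g_def case_prod_beta prod_eq_iff)
    ultimately show ?thesis unfolding plane.same_orbit_def plane.fixer_def by blast
  qed
  have base: "plane.same_orbit {} u (1, 1)" if "u \<noteq> (0, 0)" for u :: "'a \<times> 'a"
  proof (cases "fst u = 0")
    case False
    then have "plane.same_orbit {} u (fst u, 1)" by (intro R) simp_all
    moreover have "plane.same_orbit {} (fst u, 1) (1, 1)" by (intro L) simp_all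
    ultimately show ?thesis using plane.same_orbit_trans by blast
  next
    case True
    then have "snd u \<noteq> 0" using that by (simp add: prod_eq_iff)
    then have "plane.same_orbit {} u (1, snd u)" by (intro L) simp_all
    moreover have "plane.same_orbit {} (1, snd u) (1, 1)" by (intro R) simp_all
    ultimately show ?thesis using plane.same_orbit_trans by blast
  qed
  have "p \<noteq> (0, 0)" "q \<noteq> (0, 0)" using asm by (auto simp: pq)
  then have "plane.same_orbit {} p q"
    using base plane.same_orbit_sym plane.same_orbit_trans by blast
  then show "\<exists>g\<in>carrier (G_group 1 2). map g ps = qs"
    unfolding plane.same_orbit_def plane.fixer_def pq by auto
qed

text \<open>The separable word is chosen anew for each length, with \<open>m\<close> large enough
  for \<open>tuple_transitive_step\<close>.\<close>

lemma tuple_transitive_punctured_plane: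
  "plane.tuple_transitive TYPE('a::{alg_closed_field, field_char_0}) (Suc n)"
proof (induction n)
  case 0
  show ?case using tuple_transitive_1 by (simp only: One_nat_def)
next
  case (Suc n)
  obtain m \<kappa> w and F :: "'a \<Rightarrow> 'a poly" where data: "m > Suc n" "\<kappa> \<noteq> 0" "w \<in> carrier (G_group 1 2)"
    "\<And>x y. fst (w (x, y)) = poly (F x) (x + y + 1)"
    "\<And>x. degree (F x) = 2 * m" "\<And>x. coeff (F x) (2 * m) = \<kappa>" "\<And>x. coeff (F x) (2 * m - 1) = 0"
    "\<And>x. coeff (F x) (2 * m - 2) = - (\<kappa> * of_nat m * (1 + x))"
    "\<And>i. i \<le> 4 * m + 1 \<Longrightarrow> card {c. poly (F (of_nat i)) c = 0} = 2 * m"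
    using ex_separable_word[of "Suc n"] by blast
  interpret separable_word w F m \<kappa>
    by (unfold_locales; (rule data | use data(1) in simp))
  show ?case by (rule tuple_transitive_step[OF Suc]) (use data(1) in auto)
qed

lemma ex_map_in_G_group:
  fixes ps qs :: "('a::{alg_closed_field, field_char_0} \<times> 'a) list"
  assumes rs: "r * s = 2" and len: "length ps = length qs" "length ps > 0"
    and dist: "distinct ps" "distinct qs"
    and nz: "(0, 0) \<notin> set ps" "(0, 0) \<notin> set qs"
  shows "\<exists>g\<in>carrier (G_group r s). map g ps = qs"
proof -
  have *: "\<exists>g\<in>carrier (G_group 1 2). map g ps = qs"
    if "length ps = length qs" "length ps > 0" "distinct ps" "distinct qs" "(0, 0) \<notin> set ps" "(0, 0) \<notin> set qs"
    for ps qs :: "('a \<times> 'a) list"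
  proof -
    have "plane.tuple_transitive TYPE('a) (length ps)"
      using tuple_transitive_punctured_plane[where 'a = 'a and n = "length ps - 1"] that(2) by simp
    moreover have "length ps = length ps \<and> length qs = length ps \<and> distinct ps \<and> distinct qs \<and>
        set ps \<subseteq> UNIV - {(0, 0)} \<and> set qs \<subseteq> UNIV - {(0, 0)}"
      using that by auto
    ultimately show ?thesis unfolding plane.tuple_transitive_def by blast
  qed
  have "r dvd 2" using rs by (metis dvd_triv_left)
  then consider "r = 1" "s = 2" | "r = 2" "s = 1"
  proof -
    have "r = 1 \<or> r = 2" using \<open>r dvd 2\<close> two_is_prime_nat by (auto simp: prime_nat_iff)
    then show ?thesis using rs that by auto
  qed
  then show ?thesis
  proof cases
    case 1
    then show ?thesis using *[OF len dist nz] by simp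
  next
    case 2
    let ?swap = "prod.swap :: 'a \<times> 'a \<Rightarrow> 'a \<times> 'a"
    have "\<exists>g\<in>carrier (G_group 1 2). map g (map ?swap ps) = map ?swap qs"
    proof (rule *)
      show "(0, 0) \<notin> set (map ?swap ps)" "(0, 0) \<notin> set (map ?swap qs)" using nz by auto
    qed (use len dist in \<open>simp_all add: distinct_map\<close>)
    then obtain g where g: "g \<in> carrier (G_group 1 2)" "map g (map ?swap ps) = map ?swap qs" by blast
    have "map (?swap \<circ> g \<circ> ?swap) ps = map ?swap (map g (map ?swap ps))" by simp
    also have "\<dots> = qs" unfolding g(2) by (simp add: comp_def)
    finally show ?thesis using prod_swap_G_group[OF g(1)] 2 by blast
  qed
qed

theorem theorem17:
  fixes r s :: nat
  shows "((\<exists>U :: ('k::{alg_closed_field, field_char_0} \<times> 'k) set.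
             zariski_open U \<and> U \<noteq> {} \<and> invariant_set (G_group r s) U \<and>
             infinitely_transitive (G_group r s) U (tautological_action U)) \<longleftrightarrow> r * s = 2) \<and>
         (r * s = 2 \<longrightarrow>
           (\<forall>U :: ('k \<times> 'k) set.
              (zariski_open U \<and> U \<noteq> {} \<and> invariant_set (G_group r s) U \<and>
               infinitely_transitive (G_group r s) U (tautological_action U)) \<longleftrightarrow>
              U = UNIV - {(0, 0)}))"
proof -
  let ?P = "\<lambda>U :: ('k \<times> 'k) set. zariski_open U \<and> U \<noteq> {} \<and> invariant_set (G_group r s) U \<and>
             infinitely_transitive (G_group r s) U (tautological_action U)"
  have only_if: "r * s = 2" if "?P U" for U
    using that not_infinitely_transitive by blast
  have good: "?P (UNIV - {(0, 0)})" if rs: "r * s = 2"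
  proof (intro conjI)
    have rs0: "r \<noteq> 0" "s \<noteq> 0" using rs by (cases r, simp_all) (cases s, simp_all)
    have "- (UNIV - {(0, 0)}) = {v :: 'k \<times> 'k. \<forall>P\<in>{[:[:0, 1:]:], [:0, 1:]}. eval2 P v = 0}"
      by (auto simp: eval2_def)
    then show "zariski_open (UNIV - {(0 :: 'k, 0 :: 'k)})"
      unfolding zariski_open_def zariski_closed_def by blast
    have "(1, 1) \<in> UNIV - {(0 :: 'k, 0 :: 'k)}" by simp
    then show "UNIV - {(0 :: 'k, 0 :: 'k)} \<noteq> {}" by blast
    show inv: "invariant_set (G_group r s) (UNIV - {(0 :: 'k, 0 :: 'k)})"
      unfolding invariant_set_def
    proof (intro ballI subsetI)
      fix g :: "'k \<times> 'k \<Rightarrow> 'k \<times> 'k" and v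
      assume g: "g \<in> carrier (G_group r s)" and "v \<in> g ` (UNIV - {(0, 0)})"
      then obtain u where u: "v = g u" "u \<noteq> (0, 0)" by blast
      obtain h where "h \<circ> g = id" using G_group_inverse[OF g] by blast
      then have "h (g x) = x" for x by (metis comp_apply id_apply)
      then have "g u \<noteq> (0, 0)" using u(2) G_group_zero[OF g rs0] by metis
      then show "v \<in> UNIV - {(0, 0)}" using u(1) by simp
    qed
    show "infinitely_transitive (G_group r s) (UNIV - {(0 :: 'k, 0 :: 'k)}) (tautological_action (UNIV - {(0, 0)}))"
      unfolding infinitely_transitive_def
    proof (intro conjI allI impI)
      show "group_action (G_group r s) (UNIV - {(0, 0)}) (tautological_action (UNIV - {(0 :: 'k, 0 :: 'k)}))"
        by (rule group_action_tautological[OF inv])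
      fix n and ps qs :: "('k \<times> 'k) list"
      assume "0 < n" and asm: "length ps = n \<and> length qs = n \<and> distinct ps \<and> distinct qs \<and>
        set ps \<subseteq> UNIV - {(0, 0)} \<and> set qs \<subseteq> UNIV - {(0, 0)}"
      then have "\<exists>g\<in>carrier (G_group r s). map g ps = qs"
        by (intro ex_map_in_G_group[OF rs]) auto
      then obtain g where g: "g \<in> carrier (G_group r s)" "map g ps = qs" by blast
      have "map (tautological_action (UNIV - {(0, 0)}) g) ps = map g ps"
        using asm by (intro map_cong) (auto simp: tautological_action_def)
      then show "\<exists>g\<in>carrier (G_group r s). map (tautological_action (UNIV - {(0, 0)}) g) ps = qs"
        using g by metis
    qed
  qed
  \<comment> \<open>\<open>U\<close> meets the orbit of nonzero points and so contains it; the
    origin, a fixed point, would violate transitivity.\<close>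
  have unique: "U = UNIV - {(0, 0)}" if rs: "r * s = 2" and U: "?P U" for U
  proof -
    have rs0: "r \<noteq> 0" "s \<noteq> 0" using rs by (cases r, simp_all) (cases s, simp_all)
    obtain P :: "'k poly poly" where P: "P \<noteq> 0" "{v. eval2 P v \<noteq> 0} \<subseteq> U"
      using zariski_open_nonempty U by metis
    \<comment> \<open>The factor \<open>y\<close> keeps \<open>p\<close> away from the
      origin.\<close>
    have "P * [:0, 1:] \<noteq> 0" using P(1) by simp
    then obtain p where "eval2 (P * [:0, 1:]) p \<noteq> 0" using eval2_nonzero by blast
    then have "eval2 P p \<noteq> 0" "snd p \<noteq> 0" by (auto simp: eval2_def)
    then have p: "p \<in> U" "p \<noteq> (0, 0)" using P(2) by auto
    have "(0, 0) \<notin> U"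
    proof
      assume zero: "(0, 0) \<in> U"
      have "\<exists>g\<in>carrier (G_group r s). map (tautological_action U g) [(0, 0)] = [p]"
        using U zero p(1) unfolding infinitely_transitive_def
        by (elim conjE allE[of _ 1] allE[of _ "[(0, 0)]"] allE[of _ "[p]"] impE) auto
      then obtain g where g: "g \<in> carrier (G_group r s)" "g (0, 0) = p"
        using zero by (auto simp: tautological_action_def)
      then show False using G_group_zero[OF g(1) rs0] p(2) by simp
    qed
    moreover have "v \<in> U" if "v \<noteq> (0, 0)" for v
    proof -
      have "\<exists>g\<in>carrier (G_group r s). map g [p] = [v]"
        by (rule ex_map_in_G_group[OF rs]) (use p(2) that in auto)
      then obtain g where "g \<in> carrier (G_group r s)" "g p = v" by auto
      then show ?thesis using U p(1) unfolding invariant_set_def by auto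
    qed
    ultimately show ?thesis by blast
  qed
  show ?thesis using only_if good unique by blast
qed

end
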